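(* Let $M$ be a Garside monoid with Garside element $\Delta$ and set of atoms $S$, such that for every subset $S_1\subset S$ the right-lcm of $S_1$ equals $\Delta_{P_1}:=H_{P_1}(\Delta)$, where $P_1$ is the smallest standard parabolic submonoid of $M$ containing $S_1$. Assume moreover that some positive power of $\Delta$ is central in $M$. Let $G$ be the group of fractions of $M$. For two standard parabolic submonoids $P,Q$ of $M$ the following are equivalent: (i) There is $g\in G$ such that $G_P^g\cap G_Q$ is of finite index in $G_P^g$ and in $G_Q$. (ii) There is $g\in G$ such that $G_P^g=G_Q$. (iii) There exist an integer $k>0$ and $g\in G$ such that $(\Delta_P^k)^g=\Delta_Q^k$. (iv) There exists a $P$-ribbon $g\in M$ such that $P^g=Q$.
   Context: A Garside monoid $M$ is a left- and right-cancellative monoid that is Noetherian (there is no infinite sequence in which each term is a proper factor of the previous one; a factor of $x$ is a left-divisor of a right-divisor of $x$), in which any two elements have left- and right-gcd's and lcm's (so $1$ is the only invertible element), together with a Garside element $\Delta$: an element whose left-divisors and right-divisors coincide and generate $M$. Write $a\preccurlyeq b$ if $a$ left-divides $b$; the left-gcd is the greatest common left-divisor and the right-lcm is the least common right-multiple (with respect to $\preccurlyeq$). Atoms are the elements different from $1$ with no proper nontrivial divisors; $S$ denotes the set of atoms. A standard parabolic submonoid $P$ of $M$ is a submonoid closed under factors such that every $g\in M$ has a greatest left-divisor lying in $P$ (denoted $H_P(g)$, the left $P$-head) and a greatest right-divisor lying in $P$. Any intersection of standard parabolic submonoids is one, so the smallest standard parabolic submonoid containing a given set exists. An element $g\in M$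 is $P$-reduced if $H_P(g)=1$. Put $\Delta_P:=H_P(\Delta)$, which is a Garside element of $P$. For $b,g$ in $G$, $b^g:=g^{-1}bg$. For $b,g\in M$, one says that $b^g$ is defined if $g\preccurlyeq bg$ (i.e. $b^g\in M$); for $P\subset M$, $P^g$ is defined if $p^g$ is defined for all $p\in P$, and then $P^g=\{p^g: p\in P\}$. A $P$-ribbon is a $P$-reduced element $g\in M$ such that $P^g$ is defined. $G$ is the group of fractions of $M$ ($M$ is an Ore monoid and embeds in $G$). $G_P$ is the group of fractions of $P$, which is a subgroup of $G$ (the one generated by $P$). *)

theory Defs
  imports "HOL-Algebra.Algebra"
begin

text \<open>
  Left divisibility in a monoid is the library relation \<open>a divides\<^bsub>M\<^esub> b\<close>, i.e.
  \<open>\<exists>c \<in> carrier M. b = a \<otimes>\<^bsub>M\<^esub> c\<close>; for a noncommutative \<open>M\<close> the library notions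
  \<open>gcdof\<close> and \<open>lcmof\<close> built on it are therefore the left-gcd and the right-lcm.
\<close>

definition right_divides :: "('a, 'm) monoid_scheme \<Rightarrow> 'a \<Rightarrow> 'a \<Rightarrow> bool" where
  "right_divides M a b \<longleftrightarrow> (\<exists>c\<in>carrier M. b = c \<otimes>\<^bsub>M\<^esub> a)"

definition is_right_gcd :: "('a, 'm) monoid_scheme \<Rightarrow> 'a \<Rightarrow> 'a \<Rightarrow> 'a \<Rightarrow> bool" where
  "is_right_gcd M d a b \<longleftrightarrow> right_divides M d a \<and> right_divides M d b \<and>
     (\<forall>y\<in>carrier M. right_divides M y a \<and> right_divides M y b \<longrightarrow> right_divides M y d)"

definition is_left_lcm :: "('a, 'm) monoid_scheme \<Rightarrow> 'a \<Rightarrow> 'a \<Rightarrow> 'a \<Rightarrow> bool" where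
  "is_left_lcm M m a b \<longleftrightarrow> right_divides M a m \<and> right_divides M b m \<and>
     (\<forall>y\<in>carrier M. right_divides M a y \<and> right_divides M b y \<longrightarrow> right_divides M m y)"

definition is_right_lcm_of_set :: "('a, 'm) monoid_scheme \<Rightarrow> 'a \<Rightarrow> 'a set \<Rightarrow> bool" where
  "is_right_lcm_of_set M m A \<longleftrightarrow> m \<in> carrier M \<and> (\<forall>a\<in>A. a divides\<^bsub>M\<^esub> m) \<and>
     (\<forall>y\<in>carrier M. (\<forall>a\<in>A. a divides\<^bsub>M\<^esub> y) \<longrightarrow> m divides\<^bsub>M\<^esub> y)"

definition is_factor :: "('a, 'm) monoid_scheme \<Rightarrow> 'a \<Rightarrow> 'a \<Rightarrow> bool" where
  "is_factor M a x \<longleftrightarrow> a \<in> carrier M \<and> (\<exists>y\<in>carrier M. right_divides M y x \<and> a divides\<^bsub>M\<^esub> y)"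

definition is_proper_factor :: "('a, 'm) monoid_scheme \<Rightarrow> 'a \<Rightarrow> 'a \<Rightarrow> bool" where
  "is_proper_factor M a x \<longleftrightarrow> is_factor M a x \<and> a \<noteq> x"

definition atoms :: "('a, 'm) monoid_scheme \<Rightarrow> 'a set" where
  "atoms M = {s \<in> carrier M. s \<noteq> \<one>\<^bsub>M\<^esub> \<and>
     (\<forall>a\<in>carrier M. a divides\<^bsub>M\<^esub> s \<or> right_divides M a s \<longrightarrow> a = \<one>\<^bsub>M\<^esub> \<or> a = s)}"

text \<open>
  As proper factors are factors that are merely different from the element, \<open>noetherian\<close>
  already excludes invertible elements other than \<open>\<one>\<close> (an invertible \<open>u \<noteq> \<one>\<close> and \<open>\<one>\<close>
  are proper factors of each other), so that gcds and lcms are unique.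
\<close>

locale garside_monoid = monoid_cancel M for M (structure) +
  fixes \<Delta>
  assumes noetherian: "\<not> (\<exists>x. (\<forall>n::nat. x n \<in> carrier M) \<and> (\<forall>n. is_proper_factor M (x (Suc n)) (x n)))"
    and left_gcd_exists: "\<lbrakk>a \<in> carrier M; b \<in> carrier M\<rbrakk> \<Longrightarrow> \<exists>d\<in>carrier M. d gcdof a b"
    and right_gcd_exists: "\<lbrakk>a \<in> carrier M; b \<in> carrier M\<rbrakk> \<Longrightarrow> \<exists>d\<in>carrier M. is_right_gcd M d a b"
    and right_lcm_exists: "\<lbrakk>a \<in> carrier M; b \<in> carrier M\<rbrakk> \<Longrightarrow> \<exists>m\<in>carrier M. m lcmof a b"
    and left_lcm_exists: "\<lbrakk>a \<in> carrier M; b \<in> carrier M\<rbrakk> \<Longrightarrow> \<exists>m\<in>carrier M. is_left_lcm M m a b"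
    and Delta_closed: "\<Delta> \<in> carrier M"
    and Delta_divisors: "{a \<in> carrier M. a divides \<Delta>} = {a \<in> carrier M. right_divides M a \<Delta>}"
    and Delta_generates: "\<lbrakk>submonoid N M; {a \<in> carrier M. a divides \<Delta>} \<subseteq> N\<rbrakk> \<Longrightarrow> N = carrier M"

definition is_head :: "('a, 'm) monoid_scheme \<Rightarrow> 'a set \<Rightarrow> 'a \<Rightarrow> 'a \<Rightarrow> bool" where
  "is_head M P g h \<longleftrightarrow> h \<in> P \<and> h divides\<^bsub>M\<^esub> g \<and> (\<forall>y\<in>P. y divides\<^bsub>M\<^esub> g \<longrightarrow> y divides\<^bsub>M\<^esub> h)"

definition is_right_head :: "('a, 'm) monoid_scheme \<Rightarrow> 'a set \<Rightarrow> 'a \<Rightarrow> 'a \<Rightarrow> bool" where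
  "is_right_head M P g h \<longleftrightarrow> h \<in> P \<and> right_divides M h g \<and>
     (\<forall>y\<in>P. right_divides M y g \<longrightarrow> right_divides M y h)"

definition head :: "('a, 'm) monoid_scheme \<Rightarrow> 'a set \<Rightarrow> 'a \<Rightarrow> 'a" where
  "head M P g = (THE h. is_head M P g h)"

definition standard_parabolic :: "('a, 'm) monoid_scheme \<Rightarrow> 'a set \<Rightarrow> bool" where
  "standard_parabolic M P \<longleftrightarrow> submonoid P M \<and>
     (\<forall>x\<in>P. \<forall>a. is_factor M a x \<longrightarrow> a \<in> P) \<and>
     (\<forall>g\<in>carrier M. (\<exists>h. is_head M P g h) \<and> (\<exists>h. is_right_head M P g h))"

definition parabolic_closure :: "('a, 'm) monoid_scheme \<Rightarrow> 'a set \<Rightarrow> 'a set" where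
  "parabolic_closure M A = \<Inter>{P. standard_parabolic M P \<and> A \<subseteq> P}"

text \<open>\<open>P\<^sup>g\<close> is defined iff every \<open>p\<^sup>g\<close> (\<open>p \<in> P\<close>) is, i.e. iff \<open>g\<close> left-divides \<open>p g\<close> in \<open>M\<close>.\<close>

definition ribbon :: "('a, 'm) monoid_scheme \<Rightarrow> 'a set \<Rightarrow> 'a \<Rightarrow> bool" where
  "ribbon M P g \<longleftrightarrow> g \<in> carrier M \<and> head M P g = \<one>\<^bsub>M\<^esub> \<and> (\<forall>p\<in>P. g divides\<^bsub>M\<^esub> p \<otimes>\<^bsub>M\<^esub> g)"

text \<open>
  \<open>M\<close> is regarded as a submonoid of its group of fractions \<open>G\<close>. For a Garside monoid, the
  existence of common multiples makes left fractions \<open>a\<inverse> b\<close> and right fractions \<open>a b\<inverse>\<close>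
  exhaust the same elements.
\<close>

locale group_of_fractions = M?: monoid M + G?: group G
  for M :: "('a, 'm) monoid_scheme" and G :: "('a, 'g) monoid_scheme" +
  assumes carrier_subset: "carrier M \<subseteq> carrier G"
    and one_eq: "\<one>\<^bsub>M\<^esub> = \<one>\<^bsub>G\<^esub>"
    and mult_eq: "\<lbrakk>a \<in> carrier M; b \<in> carrier M\<rbrakk> \<Longrightarrow> a \<otimes>\<^bsub>M\<^esub> b = a \<otimes>\<^bsub>G\<^esub> b"
    and fraction: "x \<in> carrier G \<Longrightarrow> \<exists>a\<in>carrier M. \<exists>b\<in>carrier M. x = inv\<^bsub>G\<^esub> a \<otimes>\<^bsub>G\<^esub> b"

definition conj_elt :: "('a, 'g) monoid_scheme \<Rightarrow> 'a \<Rightarrow> 'a \<Rightarrow> 'a" where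
  "conj_elt G b g = inv\<^bsub>G\<^esub> g \<otimes>\<^bsub>G\<^esub> b \<otimes>\<^bsub>G\<^esub> g"

definition conj_set :: "('a, 'g) monoid_scheme \<Rightarrow> 'a set \<Rightarrow> 'a \<Rightarrow> 'a set" where
  "conj_set G B g = {conj_elt G b g | b. b \<in> B}"

definition finite_index :: "('a, 'g) monoid_scheme \<Rightarrow> 'a set \<Rightarrow> 'a set \<Rightarrow> bool" where
  "finite_index G H K \<longleftrightarrow> subgroup H (G\<lparr>carrier := K\<rparr>) \<and> finite (rcosets\<^bsub>G\<lparr>carrier := K\<rparr>\<^esub> H)"

text \<open>Heads are unique, so the description operator in \<open>head\<close> is harmless.\<close>

lemma (in garside_monoid) unit_eq_one:
  assumes "a \<in> carrier M" "b \<in> carrier M" "a \<otimes> b = \<one>"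
  shows "a = \<one>"
proof (rule ccontr)
  assume ne: "a \<noteq> \<one>"
  have fac: "is_factor M u v" if "u \<in> carrier M" "v \<in> carrier M" "u divides v" for u v
    unfolding is_factor_def right_divides_def
    using that by (intro conjI bexI[of _ v] bexI[of _ \<one>]) simp_all
  have "a divides \<one>"
    unfolding factor_def using assms by (intro bexI[of _ b]) simp_all
  moreover have "\<one> divides a"
    unfolding factor_def using assms by (intro bexI[of _ a]) simp_all
  ultimately have "is_proper_factor M a \<one>" "is_proper_factor M \<one> a"
    unfolding is_proper_factor_def
    using fac[of a \<one>] fac[of \<one> a] assms(1) ne by blast+
  then have "is_proper_factor M (if even (Suc n) then a else \<one>) (if even n then a else \<one>)" for n
    by simp
  moreover have "(if even n then a else \<one>) \<in> carrier M" for n :: nat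
    using assms by simp
  ultimately have "\<exists>x. (\<forall>n::nat. x n \<in> carrier M) \<and> (\<forall>n. is_proper_factor M (x (Suc n)) (x n))"
    by (intro exI[of _ "\<lambda>n. if even n then a else \<one>"]) (intro conjI allI)
  then show False
    using noetherian by contradiction
qed

lemma (in garside_monoid) head_equality:
  assumes "standard_parabolic M P" "is_head M P g h"
  shows "head M P g = h"
  unfolding head_def
proof (rule the_equality)
  show "is_head M P g h" by fact
next
  fix k assume k: "is_head M P g k"
  have sub: "P \<subseteq> carrier M"
    using assms(1) by (auto simp: standard_parabolic_def dest: submonoid.subset)
  have hk: "h \<in> carrier M" "k \<in> carrier M" "h divides k" "k divides h"
    using assms(2) k sub by (auto simp: is_head_def)
  then obtain c d where cd: "c \<in> carrier M" "d \<in> carrier M" "k = h \<otimes> c" "h = k \<otimes> d"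
    unfolding factor_def by blast
  have "h \<otimes> (c \<otimes> d) = (h \<otimes> c) \<otimes> d"
    using hk(1) cd(1,2) by (simp only: m_assoc)
  also have "\<dots> = h \<otimes> \<one>"
    unfolding cd(3) [symmetric] cd(4) [symmetric] using hk(1) by (rule r_one [symmetric])
  finally have "c \<otimes> d = \<one>"
    by (rule l_cancel) (simp_all add: hk(1) cd(1,2))
  then have "c = \<one>"
    by (rule unit_eq_one [OF cd(1,2)])
  then show "k = h"
    using cd(3) hk(1) by simp
qed

end

theory Submission
  imports Defs
begin

text \<open>
  Write \<open>\<delta> P\<close> for the Garside element \<open>H\<^sub>P(\<Delta>)\<close>. The heart of the matter is to obtain a ribbon from
  a single conjugated element, and the elements that allow this are the \<^emph>\<open>full\<close> ones: \<open>b \<in> P\<close> is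
  full if every element of \<open>P\<close> divides a power of \<open>b\<close>. Positive powers of \<open>\<delta> P\<close> are full.

  Suppose that \<open>b g = g c\<close> with \<open>g \<in> M\<close> and \<open>b\<close>, \<open>c\<close> full in \<open>P\<close>, \<open>Q\<close>. Removing the \<open>P\<close>-head of \<open>g\<close>
  replaces \<open>b\<close> by a conjugate which is still a full element of \<open>P\<close>
  (\<open>full_conj_reduced_intertwines\<close>), so let \<open>g\<close> be \<open>P\<close>-reduced. If \<open>g = \<one>\<close>, then \<open>b = c\<close> is full in
  both \<open>P\<close> and \<open>Q\<close>, which forces \<open>P = Q\<close>. Otherwise let \<open>t\<close> be an atom dividing \<open>g\<close> and \<open>R\<close> the
  parabolic closure of \<open>P\<close> and \<open>t\<close>. Some \<open>b\<^sup>j g = g c\<^sup>j\<close> is divisible by \<open>\<delta> P\<close> and by \<open>t\<close>, hence by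
  all atoms of \<open>P\<close> and by \<open>t\<close>, and the lcm of these is \<open>\<delta> R = \<delta> P r\<close> by the hypothesis on lcms of
  atoms. The element \<open>r\<close> is a ribbon from \<open>P\<close> to another parabolic \<open>P'\<close> (\<open>elementary_ribbon\<close>), and
  reducedness shows that \<open>r\<close> divides \<open>g\<close> itself. The cofactor of \<open>r\<close> in \<open>g\<close> satisfies the same
  hypotheses for \<open>P'\<close> and is a proper factor of \<open>g\<close>, so Noetherian induction writes \<open>g\<close> as a
  product of elementary ribbons (\<open>full_conj_intertwines\<close>).

  This gives (iii) \<open>\<Longrightarrow>\<close> (iv), once the conjugating element has been moved into \<open>M\<close> by a central
  power of \<open>\<Delta>\<close>. For (i) \<open>\<Longrightarrow>\<close> (iv), finite index provides \<open>k > 0\<close> such that \<open>g\<close> conjugates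
  \<open>\<delta> P\<^sup>k\<close> into \<open>G\<^sub>Q\<close>. After \<open>g\<close> is made to have no right divisor in \<open>Q\<close> other than \<open>\<one>\<close>, elements of \<open>M\<close>
  conjugated into \<open>G\<^sub>Q\<close> are conjugated into \<open>Q\<close> (\<open>conj_in_parabolic\<close>), and the other finite index
  makes the conjugate of \<open>\<delta> P\<^sup>k\<close> full in \<open>Q\<close> (\<open>commensurable_imp_intertwines\<close>). Finally (iv) gives
  (ii) by passing to generated subgroups, and it gives (iii) with exponent \<open>1\<close> because a
  conjugation from \<open>P\<close> onto \<open>Q\<close> matches atoms and therefore their lcms (\<open>intertwines_delta\<close>).
\<close>

section \<open>Factors, atoms and Noetherian induction\<close>

context garside_monoid
begin

lemma factorI:
  assumes "a \<in> carrier M" "u \<in> carrier M" "v \<in> carrier M"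
  shows "is_factor M a (u \<otimes> (a \<otimes> v))"
  unfolding is_factor_def right_divides_def factor_def using assms by blast

lemma factorE:
  assumes "is_factor M a x"
  obtains u v where "a \<in> carrier M" "u \<in> carrier M" "v \<in> carrier M" "x = u \<otimes> (a \<otimes> v)"
  using assms unfolding is_factor_def right_divides_def factor_def by blast

lemma divides_imp_factor:
  assumes "a \<in> carrier M" "b \<in> carrier M" "a divides b"
  shows "is_factor M a b"
proof -
  obtain c where "c \<in> carrier M" "b = a \<otimes> c"
    using assms(3) by (auto simp: factor_def)
  then show ?thesis
    using factorI[OF assms(1) one_closed] assms by force
qed

lemma right_divides_imp_factor:
  assumes "a \<in> carrier M" "b \<in> carrier M" "right_divides M a b"
  shows "is_factor M a b"
proof -
  obtain c where "c \<in> carrier M" "b = c \<otimes> a"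
    using assms(3) by (auto simp: right_divides_def)
  then show ?thesis
    using factorI[OF assms(1) _ one_closed] assms by force
qed

lemma proper_factor_wf:
  "wf {(a, x). a \<in> carrier M \<and> x \<in> carrier M \<and> is_proper_factor M a x}"
  unfolding wf_iff_no_infinite_down_chain using noetherian by auto

lemma factor_antisym:
  assumes "is_factor M a b" "is_factor M b a"
  shows "a = b"
proof (rule ccontr)
  assume "a \<noteq> b"
  then have "(a, b) \<in> {(a, x). a \<in> carrier M \<and> x \<in> carrier M \<and> is_proper_factor M a x}"
    "(b, a) \<in> {(a, x). a \<in> carrier M \<and> x \<in> carrier M \<and> is_proper_factor M a x}"
    using assms by (auto simp: is_proper_factor_def is_factor_def)
  then show False
    using proper_factor_wf by (meson wf_asym)
qed

lemma divides_antisym: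
  assumes "a \<in> carrier M" "b \<in> carrier M" "a divides b" "b divides a"
  shows "a = b"
  using assms by (intro factor_antisym divides_imp_factor)

lemma eq_mult_right_imp_one:
  assumes "a \<in> carrier M" "b \<in> carrier M" "a \<otimes> b = a"
  shows "b = \<one>"
  using assms l_cancel[of a b \<one>] by simp

lemma eq_mult_left_imp_one:
  assumes "a \<in> carrier M" "b \<in> carrier M" "b \<otimes> a = a"
  shows "b = \<one>"
  using assms r_cancel[of b a \<one>] by simp

lemma atom_iff:
  "s \<in> atoms M \<longleftrightarrow> s \<in> carrier M \<and> s \<noteq> \<one> \<and>
     (\<forall>a\<in>carrier M. \<forall>b\<in>carrier M. s = a \<otimes> b \<longrightarrow> a = \<one> \<or> b = \<one>)" (is "_ \<longleftrightarrow> ?R")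
proof
  assume s: "s \<in> atoms M"
  show ?R
  proof (intro conjI ballI impI)
    fix a b assume ab: "a \<in> carrier M" "b \<in> carrier M" "s = a \<otimes> b"
    then have "a = \<one> \<or> a = s"
      using s unfolding atoms_def factor_def by blast
    then show "a = \<one> \<or> b = \<one>"
      using ab eq_mult_right_imp_one[of a b] by auto
  qed (use s in \<open>auto simp: atoms_def\<close>)
next
  assume R: ?R
  show "s \<in> atoms M"
    unfolding atoms_def factor_def right_divides_def
  proof (intro CollectI conjI ballI impI)
    fix a assume a: "a \<in> carrier M" "(\<exists>c\<in>carrier M. s = a \<otimes> c) \<or> (\<exists>c\<in>carrier M. s = c \<otimes> a)"
    then show "a = \<one> \<or> a = s"
      using R by (metis l_one r_one)
  qed (use R in auto)
qed

lemma atom_divides_exists: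
  assumes "g \<in> carrier M" "g \<noteq> \<one>"
  shows "\<exists>t\<in>atoms M. t divides g"
  using assms
proof (induction g rule: wf_induct_rule[OF proper_factor_wf])
  case (1 g)
  show ?case
  proof (cases "g \<in> atoms M")
    case True
    then show ?thesis using 1 by (intro bexI[of _ g]) auto
  next
    case False
    then obtain a b where ab: "a \<in> carrier M" "b \<in> carrier M" "g = a \<otimes> b" "a \<noteq> \<one>" "b \<noteq> \<one>"
      using 1 by (auto simp: atom_iff)
    have ag: "a divides g" using ab by (auto simp: factor_def)
    have "a \<noteq> g" using ab eq_mult_right_imp_one[of a b] by auto
    then have "is_proper_factor M a g"
      using ag ab 1 divides_imp_factor[of a g] by (auto simp: is_proper_factor_def)
    then obtain t where "t \<in> atoms M" "t divides a"
      using 1(1)[of a] 1(2) ab by auto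
    then show ?thesis
      using ag ab by (meson atom_iff divides_trans)
  qed
qed

lemma atom_mult_proper_factor:
  assumes "s \<in> atoms M" "x \<in> carrier M"
  shows "is_proper_factor M x (s \<otimes> x)"
proof -
  have s: "s \<in> carrier M" "s \<noteq> \<one>" using assms by (auto simp: atom_iff)
  have "right_divides M x (s \<otimes> x)" using s by (auto simp: right_divides_def)
  then have "is_factor M x (s \<otimes> x)"
    using assms s by (intro right_divides_imp_factor) auto
  moreover have "x \<noteq> s \<otimes> x" using eq_mult_left_imp_one[of x s] s assms by auto
  ultimately show ?thesis by (auto simp: is_proper_factor_def)
qed

section \<open>Standard parabolic submonoids and their heads\<close>

lemma parabolic_subset:
  assumes "standard_parabolic M P" "x \<in> P"
  shows "x \<in> carrier M"
  using assms by (auto simp: standard_parabolic_def dest: submonoid.subset)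

lemma parabolic_mult:
  assumes "standard_parabolic M P" "x \<in> P" "y \<in> P"
  shows "x \<otimes> y \<in> P"
  using assms by (auto simp: standard_parabolic_def submonoid.m_closed)

lemma parabolic_one:
  assumes "standard_parabolic M P"
  shows "\<one> \<in> P"
  using assms by (auto simp: standard_parabolic_def submonoid.one_closed)

lemma parabolic_pow:
  assumes "standard_parabolic M P" "x \<in> P"
  shows "x [^] (n::nat) \<in> P"
  by (induction n) (use assms parabolic_one parabolic_mult in auto)

lemma parabolic_factor:
  assumes "standard_parabolic M P" "x \<in> P" "is_factor M a x"
  shows "a \<in> P"
  using assms by (auto simp: standard_parabolic_def)

lemma parabolic_divides:
  assumes "standard_parabolic M P" "x \<in> P" "a \<in> carrier M" "a divides x"
  shows "a \<in> P"
  using assms divides_imp_factor parabolic_factor parabolic_subset by meson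

lemma parabolic_right_divides:
  assumes "standard_parabolic M P" "x \<in> P" "a \<in> carrier M" "right_divides M a x"
  shows "a \<in> P"
  using assms right_divides_imp_factor parabolic_factor parabolic_subset by meson

lemma parabolic_of_mult:
  assumes "standard_parabolic M P" "a \<otimes> b \<in> P" "a \<in> carrier M" "b \<in> carrier M"
  shows "a \<in> P" "b \<in> P"
  using assms parabolic_divides[OF assms(1,2), of a] parabolic_right_divides[OF assms(1,2), of b]
  by (auto simp: factor_def right_divides_def)

lemma carrier_parabolic: "standard_parabolic M (carrier M)"
  unfolding standard_parabolic_def
proof (intro conjI ballI allI impI)
  show "submonoid (carrier M) M" by unfold_locales auto
next
  fix g assume "g \<in> carrier M"
  then show "\<exists>h. is_head M (carrier M) g h" "\<exists>h. is_right_head M (carrier M) g h"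
    by (auto simp: is_head_def is_right_head_def right_divides_def intro!: exI[of _ g] bexI[of _ \<one>])
qed (auto simp: is_factor_def)

lemma head_is_head:
  assumes "standard_parabolic M P" "g \<in> carrier M"
  shows "is_head M P g (head M P g)"
  using assms head_equality unfolding standard_parabolic_def by (metis assms(1))

lemma headD:
  assumes "standard_parabolic M P" "g \<in> carrier M"
  shows "head M P g \<in> P" "head M P g \<in> carrier M" "head M P g divides g"
    "\<And>y. y \<in> P \<Longrightarrow> y divides g \<Longrightarrow> y divides head M P g"
  using head_is_head[OF assms] parabolic_subset[OF assms(1)] by (auto simp: is_head_def)

text \<open>The head of a common multiple of two elements of \<open>P\<close> is again a common multiple of them;
  this is why \<open>P\<close> absorbs least common multiples.\<close>

lemma parabolic_right_lcm:
  assumes P: "standard_parabolic M P" and "x \<in> P" "y \<in> P" "m \<in> carrier M" "m lcmof x y"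
  shows "m \<in> P"
proof -
  have "x divides head M P m" "y divides head M P m"
    using headD(4)[OF P assms(4)] assms by (auto simp: islcm_def)
  then have "m divides head M P m"
    using assms headD(2)[OF P assms(4)] by (auto simp: islcm_def)
  then show ?thesis
    using parabolic_divides P headD(1)[OF P assms(4)] assms(4) by blast
qed

lemma parabolic_left_lcm:
  assumes P: "standard_parabolic M P" and "x \<in> P" "y \<in> P" "m \<in> carrier M" "is_left_lcm M m x y"
  shows "m \<in> P"
proof -
  obtain h where h: "is_right_head M P m h"
    using P assms(4) by (auto simp: standard_parabolic_def)
  then have "right_divides M x h" "right_divides M y h" "h \<in> P"
    using assms by (auto simp: is_right_head_def is_left_lcm_def)
  then have "right_divides M m h"
    using assms parabolic_subset[OF P] by (auto simp: is_left_lcm_def)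
  then show ?thesis
    using parabolic_right_divides P \<open>h \<in> P\<close> assms(4) by blast
qed

lemma head_mult:
  assumes P: "standard_parabolic M P" and p: "p \<in> P" and g: "g \<in> carrier M"
    and y: "y \<in> P" "y divides p \<otimes> g"
  shows "y divides p \<otimes> head M P g"
proof -
  have c: "p \<in> carrier M" "y \<in> carrier M" using p y parabolic_subset[OF P] by auto
  obtain m where m: "m \<in> carrier M" "m lcmof y p"
    using right_lcm_exists c by blast
  then have mP: "m \<in> P" using parabolic_right_lcm[OF P y(1) p] by blast
  obtain u where u: "u \<in> carrier M" "m = p \<otimes> u"
    using m by (auto simp: islcm_def factor_def)
  have "m divides p \<otimes> g"
    using m y c g by (auto simp: islcm_def)
  then have "u divides g"
    using u c g by (simp add: divides_mult_l)
  moreover have "u \<in> P" using parabolic_of_mult(2)[OF P _ c(1) u(1)] u mP by simp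
  ultimately have "u divides head M P g" using headD(4)[OF P g] by blast
  then have "m divides p \<otimes> head M P g"
    using u c headD(2)[OF P g] by (simp add: divides_mult_l)
  moreover have "y divides m" using m by (auto simp: islcm_def)
  ultimately show ?thesis
    using c by (meson divides_trans)
qed

text \<open>The left lcm \<open>m = c \<otimes> u\<close> of \<open>v\<close> and \<open>u\<close> lies in \<open>Q\<close>, hence so does \<open>c\<close>, and \<open>c\<close> is a right
  divisor of \<open>g\<close>.\<close>

lemma right_divides_cancel_reduced:
  assumes Q: "standard_parabolic M Q" and u: "u \<in> Q" and v: "v \<in> Q" and g: "g \<in> carrier M"
    and red: "\<And>y. y \<in> Q \<Longrightarrow> right_divides M y g \<Longrightarrow> y = \<one>"
    and vgu: "right_divides M v (g \<otimes> u)"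
  shows "right_divides M v u"
proof -
  have uc: "u \<in> carrier M" and vc: "v \<in> carrier M" using u v parabolic_subset[OF Q] by auto
  obtain m where m: "m \<in> carrier M" "is_left_lcm M m v u" using left_lcm_exists uc vc by blast
  then have mQ: "m \<in> Q" using parabolic_left_lcm[OF Q v u] by blast
  obtain c where c: "c \<in> carrier M" "m = c \<otimes> u" using m by (auto simp: is_left_lcm_def right_divides_def)
  have cQ: "c \<in> Q" using parabolic_of_mult(1)[OF Q, of c u] c mQ uc by simp
  have "right_divides M u (g \<otimes> u)" using g by (auto simp: right_divides_def)
  then have "right_divides M m (g \<otimes> u)" using m vgu g uc by (auto simp: is_left_lcm_def)
  then obtain d where d: "d \<in> carrier M" "g \<otimes> u = d \<otimes> m" by (auto simp: right_divides_def)
  then have "g \<otimes> u = (d \<otimes> c) \<otimes> u" using c uc m_assoc by simp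
  then have "g = d \<otimes> c" using r_cancel g uc c d by (meson m_closed)
  then have "c = \<one>" using red cQ d by (auto simp: right_divides_def)
  then have "m = u" using c uc by simp
  then show ?thesis using m by (simp add: is_left_lcm_def)
qed

text \<open>A head for the intersection is found by descent: among the left divisors \<open>h\<close> of \<open>g\<close> that
  still bound every left divisor of \<open>g\<close> in the intersection, a minimal one is fixed by passing to
  the \<open>P\<close>-head for each member \<open>P\<close> of the family, hence it lies in all of them.\<close>

lemma inter_parabolic:
  assumes F: "\<And>P. P \<in> F \<Longrightarrow> standard_parabolic M P" and ne: "F \<noteq> {}"
  shows "standard_parabolic M (\<Inter>F)"
  unfolding standard_parabolic_def
proof (intro conjI ballI allI impI)
  show "submonoid (\<Inter>F) M"
    using ne F parabolic_subset[OF F] parabolic_mult[OF F] parabolic_one[OF F]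
    by unfold_locales blast+
next
  fix x a assume "x \<in> \<Inter>F" "is_factor M a x"
  then show "a \<in> \<Inter>F" using parabolic_factor[OF F] by blast
next
  fix g assume g: "g \<in> carrier M"
  let ?B = "{h \<in> carrier M. h divides g \<and> (\<forall>x\<in>\<Inter>F. x divides g \<longrightarrow> x divides h)}"
  have "g \<in> ?B" using g by auto
  then obtain h where h: "h \<in> ?B"
    and hmin: "\<And>y. (y, h) \<in> {(a, x). a \<in> carrier M \<and> x \<in> carrier M \<and> is_proper_factor M a x} \<Longrightarrow> y \<notin> ?B"
    using wfE_min[OF proper_factor_wf, of g ?B] by blast
  have "h \<in> P" if PF: "P \<in> F" for P
  proof -
    have P: "standard_parabolic M P" using F PF by blast
    have hc: "h \<in> carrier M" using h by blast
    note hd = headD[OF P hc]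
    have "head M P h \<in> ?B"
    proof (intro CollectI conjI ballI impI)
      show "head M P h divides g" using hd h divides_trans by blast
      show "x divides head M P h" if "x \<in> \<Inter>F" "x divides g" for x
        using hd(4) that h PF by blast
    qed (use hd in auto)
    then have "\<not> is_proper_factor M (head M P h) h"
      using hmin hd(2) hc by blast
    then have "head M P h = h"
      using divides_imp_factor[OF hd(2) hc hd(3)] by (auto simp: is_proper_factor_def)
    then show "h \<in> P" using hd(1) by simp
  qed
  then show "\<exists>h. is_head M (\<Inter>F) g h"
    using h by (intro exI[of _ h]) (auto simp: is_head_def)
next
  fix g assume g: "g \<in> carrier M"
  let ?B = "{h \<in> carrier M. right_divides M h g \<and> (\<forall>x\<in>\<Inter>F. right_divides M x g \<longrightarrow> right_divides M x h)}"
  have "g \<in> ?B" using g by (auto simp: right_divides_def intro!: bexI[of _ \<one>])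
  then obtain h where h: "h \<in> ?B"
    and hmin: "\<And>y. (y, h) \<in> {(a, x). a \<in> carrier M \<and> x \<in> carrier M \<and> is_proper_factor M a x} \<Longrightarrow> y \<notin> ?B"
    using wfE_min[OF proper_factor_wf, of g ?B] by blast
  have "h \<in> P" if PF: "P \<in> F" for P
  proof -
    have P: "standard_parabolic M P" using F PF by blast
    have hc: "h \<in> carrier M" using h by blast
    obtain k where k: "is_right_head M P h k"
      using P hc by (auto simp: standard_parabolic_def)
    then have kP: "k \<in> P" "k \<in> carrier M" "right_divides M k h"
      using parabolic_subset[OF P] by (auto simp: is_right_head_def)
    have "k \<in> ?B"
    proof (intro CollectI conjI ballI impI)
      obtain u v where "u \<in> carrier M" "v \<in> carrier M" "g = u \<otimes> h" "h = v \<otimes> k"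
        using h kP by (auto simp: right_divides_def)
      then show "right_divides M k g"
        using kP m_assoc[of u v k] by (auto simp: right_divides_def intro!: bexI[of _ "u \<otimes> v"])
      show "right_divides M x k" if "x \<in> \<Inter>F" "right_divides M x g" for x
        using k that h PF by (auto simp: is_right_head_def)
    qed (use kP in auto)
    then have "\<not> is_proper_factor M k h"
      using hmin kP hc by blast
    then have "k = h"
      using right_divides_imp_factor[OF kP(2) hc kP(3)] by (auto simp: is_proper_factor_def)
    then show "h \<in> P" using kP by simp
  qed
  then show "\<exists>h. is_right_head M (\<Inter>F) g h"
    using h by (intro exI[of _ h]) (auto simp: is_right_head_def)
qed

lemma closure_parabolic:
  assumes "A \<subseteq> carrier M"
  shows "standard_parabolic M (parabolic_closure M A)"
  unfolding parabolic_closure_def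
  using assms carrier_parabolic by (intro inter_parabolic) auto

lemma closure_least:
  assumes "standard_parabolic M P" "A \<subseteq> P"
  shows "parabolic_closure M A \<subseteq> P"
  using assms by (auto simp: parabolic_closure_def)

lemma closure_superset: "A \<subseteq> parabolic_closure M A"
  by (auto simp: parabolic_closure_def)

lemma parabolic_atom_induct [consumes 2, case_names one mult]:
  assumes P: "standard_parabolic M P" and "p \<in> P"
    and one: "Pr \<one>"
    and step: "\<And>s x. s \<in> atoms M \<Longrightarrow> s \<in> P \<Longrightarrow> x \<in> P \<Longrightarrow> Pr x \<Longrightarrow> Pr (s \<otimes> x)"
  shows "Pr p"
  using \<open>p \<in> P\<close>
proof (induction p rule: wf_induct_rule[OF proper_factor_wf])
  case (1 p)
  have p: "p \<in> carrier M" using 1 parabolic_subset[OF P] by blast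
  show ?case
  proof (cases "p = \<one>")
    case False
    then obtain s x where s: "s \<in> atoms M" "s \<in> carrier M" "x \<in> carrier M" "p = s \<otimes> x"
      using atom_divides_exists[OF p] by (auto simp: factor_def atom_iff)
    then have "s \<in> P" "x \<in> P" using parabolic_of_mult[OF P, of s x] 1(2) by auto
    moreover have "is_proper_factor M x p" using atom_mult_proper_factor s by auto
    ultimately show ?thesis using step s 1(1)[of x] p by auto
  qed (use one in auto)
qed

lemma closure_atoms:
  assumes P: "standard_parabolic M P"
  shows "parabolic_closure M (atoms M \<inter> P) = P"
proof
  have C: "standard_parabolic M (parabolic_closure M (atoms M \<inter> P))"
    by (rule closure_parabolic) (auto simp: atom_iff)
  show "P \<subseteq> parabolic_closure M (atoms M \<inter> P)"
  proof
    fix p assume "p \<in> P"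
    with P show "p \<in> parabolic_closure M (atoms M \<inter> P)"
    proof (induction p rule: parabolic_atom_induct)
      case (mult s x)
      then show ?case using parabolic_mult[OF C] closure_superset by blast
    qed (rule parabolic_one[OF C])
  qed
next
  show "parabolic_closure M (atoms M \<inter> P) \<subseteq> P"
    by (rule closure_least[OF P]) simp
qed

end

section \<open>The Garside element of a parabolic submonoid\<close>

context garside_monoid
begin

abbreviation parabolic_Delta :: "'a set \<Rightarrow> 'a" ("\<delta>") where
  "\<delta> P \<equiv> head M P \<Delta>"

lemma Delta_balanced:
  assumes "y \<in> carrier M"
  shows "y divides \<Delta> \<longleftrightarrow> right_divides M y \<Delta>"
  using Delta_divisors assms by blast

lemma right_divides_trans:
  assumes "right_divides M a b" "right_divides M b c" "a \<in> carrier M"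
  shows "right_divides M a c"
proof -
  obtain u v where "u \<in> carrier M" "v \<in> carrier M" "b = u \<otimes> a" "c = v \<otimes> b"
    using assms by (auto simp: right_divides_def)
  then have "c = (v \<otimes> u) \<otimes> a" "v \<otimes> u \<in> carrier M" using assms m_assoc by auto
  then show ?thesis unfolding right_divides_def by blast
qed

text \<open>The divisors of \<open>\<Delta>\<close> lying in \<open>P\<close> have a greatest element for each of the two
  divisibility orders. Each of these two elements is a factor of the other, so they coincide.\<close>

lemma delta_right_head:
  assumes P: "standard_parabolic M P"
  shows "is_right_head M P \<Delta> (\<delta> P)"
proof -
  obtain y where y: "is_right_head M P \<Delta> y"
    using P Delta_closed by (auto simp: standard_parabolic_def)
  then have yP: "y \<in> P" "y \<in> carrier M" "right_divides M y \<Delta>"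
    using parabolic_subset[OF P] by (auto simp: is_right_head_def)
  note h = headD[OF P Delta_closed]
  have "y divides \<delta> P" using h(4) yP Delta_balanced by blast
  moreover have "right_divides M (\<delta> P) y"
    using y h(1-3) Delta_balanced by (auto simp: is_right_head_def)
  ultimately have "\<delta> P = y"
    using factor_antisym divides_imp_factor right_divides_imp_factor yP(2) h(2) by blast
  then show ?thesis using y by simp
qed

lemma delta_closed:
  assumes "standard_parabolic M P"
  shows "\<delta> P \<in> P" "\<delta> P \<in> carrier M"
  using headD[OF assms Delta_closed] by auto

lemma divides_delta_iff:
  assumes "standard_parabolic M P" "y \<in> P"
  shows "y divides \<delta> P \<longleftrightarrow> y divides \<Delta>"
  using headD[OF assms(1) Delta_closed] assms divides_trans parabolic_subset by metis

lemma right_divides_delta_iff: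
  assumes "standard_parabolic M P" "y \<in> P"
  shows "right_divides M y (\<delta> P) \<longleftrightarrow> right_divides M y \<Delta>"
  using delta_right_head[OF assms(1)] right_divides_trans parabolic_subset assms
  unfolding is_right_head_def by metis

lemma delta_balanced:
  assumes P: "standard_parabolic M P" and y: "y \<in> carrier M"
  shows "y divides \<delta> P \<longleftrightarrow> right_divides M y (\<delta> P)"
  using divides_delta_iff[OF P, of y] right_divides_delta_iff[OF P, of y] Delta_balanced[OF y]
    parabolic_divides[OF P delta_closed(1)[OF P] y] parabolic_right_divides[OF P delta_closed(1)[OF P] y]
  by blast

text \<open>If \<open>\<delta> P = x a = a b\<close>, then \<open>x (\<delta> P) = x a b = (\<delta> P) b\<close>.\<close>

lemma delta_twist:
  assumes P: "standard_parabolic M P" and x: "x \<in> carrier M" "x divides \<delta> P"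
  shows "\<exists>y\<in>carrier M. y divides \<delta> P \<and> x \<otimes> \<delta> P = \<delta> P \<otimes> y"
    "\<exists>y\<in>carrier M. y divides \<delta> P \<and> \<delta> P \<otimes> x = y \<otimes> \<delta> P"
proof -
  note d = delta_closed(2)[OF P]
  obtain a where a: "a \<in> carrier M" "\<delta> P = x \<otimes> a"
    using x by (auto simp: factor_def)
  then have "a divides \<delta> P"
    using delta_balanced[OF P a(1)] x by (auto simp: right_divides_def)
  then obtain b where b: "b \<in> carrier M" "\<delta> P = a \<otimes> b"
    by (auto simp: factor_def)
  then have "b divides \<delta> P"
    using delta_balanced[OF P b(1)] a by (auto simp: right_divides_def)
  moreover have "x \<otimes> \<delta> P = \<delta> P \<otimes> b"
    using a b x m_assoc[of x a b] by metis
  ultimately show "\<exists>y\<in>carrier M. y divides \<delta> P \<and> x \<otimes> \<delta> P = \<delta> P \<otimes> y"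
    using b by blast
next
  obtain a where a: "a \<in> carrier M" "\<delta> P = a \<otimes> x"
    using delta_balanced[OF P x(1)] x by (auto simp: right_divides_def)
  then have "right_divides M a (\<delta> P)"
    using delta_balanced[OF P a(1)] x by (auto simp: factor_def)
  then obtain b where b: "b \<in> carrier M" "\<delta> P = b \<otimes> a"
    by (auto simp: right_divides_def)
  then have "b divides \<delta> P"
    using a by (auto simp: factor_def)
  moreover have "\<delta> P \<otimes> x = b \<otimes> \<delta> P"
    using a b x m_assoc[of b a x] by metis
  ultimately show "\<exists>y\<in>carrier M. y divides \<delta> P \<and> \<delta> P \<otimes> x = y \<otimes> \<delta> P"
    using b by blast
qed

lemma delta_pow_twist:
  assumes P: "standard_parabolic M P" and x: "x \<in> carrier M" "x divides \<delta> P"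
  shows "\<exists>y\<in>carrier M. y divides \<delta> P \<and> x \<otimes> \<delta> P [^] (j::nat) = \<delta> P [^] j \<otimes> y"
proof (induction j)
  case 0
  then show ?case using x by auto
next
  case (Suc j)
  note d = delta_closed(2)[OF P]
  obtain y where y: "y \<in> carrier M" "y divides \<delta> P" "x \<otimes> \<delta> P [^] j = \<delta> P [^] j \<otimes> y"
    using Suc by blast
  obtain z where z: "z \<in> carrier M" "z divides \<delta> P" "y \<otimes> \<delta> P = \<delta> P \<otimes> z"
    using delta_twist(1)[OF P y(1,2)] by blast
  have "x \<otimes> \<delta> P [^] Suc j = (x \<otimes> \<delta> P [^] j) \<otimes> \<delta> P" using x d m_assoc by simp
  also have "\<dots> = \<delta> P [^] j \<otimes> (y \<otimes> \<delta> P)" using y d m_assoc by simp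
  also have "\<dots> = \<delta> P [^] Suc j \<otimes> z" using z d m_assoc by simp
  finally show ?case using z by blast
qed

section \<open>Intertwining elements\<close>

text \<open>For \<open>A, B \<subseteq> M\<close> this is the equation \<open>A\<^sup>g = B\<close>, written without inverses so that it makes sense
  before the group of fractions is brought in.\<close>

definition intertwines :: "'a \<Rightarrow> 'a set \<Rightarrow> 'a set \<Rightarrow> bool" where
  "intertwines g A B \<longleftrightarrow> g \<in> carrier M \<and>
     (\<forall>a\<in>A. \<exists>b\<in>B. a \<otimes> g = g \<otimes> b) \<and> (\<forall>b\<in>B. \<exists>a\<in>A. a \<otimes> g = g \<otimes> b)"

lemma intertwinesD:
  assumes "intertwines g A B"
  shows "g \<in> carrier M" "\<And>a. a \<in> A \<Longrightarrow> \<exists>b\<in>B. a \<otimes> g = g \<otimes> b"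
    "\<And>b. b \<in> B \<Longrightarrow> \<exists>a\<in>A. a \<otimes> g = g \<otimes> b"
  using assms by (auto simp: intertwines_def)

lemma conj_mult:
  assumes "a \<in> carrier M" "b \<in> carrier M" "c \<in> carrier M" "d \<in> carrier M" "g \<in> carrier M"
    and "a \<otimes> g = g \<otimes> c" "b \<otimes> g = g \<otimes> d"
  shows "(a \<otimes> b) \<otimes> g = g \<otimes> (c \<otimes> d)"
proof -
  have "(a \<otimes> b) \<otimes> g = a \<otimes> (g \<otimes> d)" using assms m_assoc by simp
  also have "\<dots> = (a \<otimes> g) \<otimes> d" using assms(1-5) m_assoc by simp
  also have "\<dots> = g \<otimes> (c \<otimes> d)" unfolding assms(6) using assms(1-5) m_assoc by simp
  finally show ?thesis .
qed

lemma conj_pow: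
  assumes "b \<in> carrier M" "c \<in> carrier M" "g \<in> carrier M" "b \<otimes> g = g \<otimes> c"
  shows "b [^] (j::nat) \<otimes> g = g \<otimes> c [^] j"
  by (induction j) (use assms conj_mult in auto)

lemma intertwines_comp:
  assumes "intertwines g A B" "intertwines h B C"
    and sub: "A \<subseteq> carrier M" "B \<subseteq> carrier M" "C \<subseteq> carrier M"
  shows "intertwines (g \<otimes> h) A C"
proof -
  note g = intertwinesD[OF assms(1)] and h = intertwinesD[OF assms(2)]
  have comp: "a \<otimes> (g \<otimes> h) = (g \<otimes> h) \<otimes> c"
    if abc: "a \<in> A" "b \<in> B" "c \<in> C" and e: "a \<otimes> g = g \<otimes> b" "b \<otimes> h = h \<otimes> c" for a b c
  proof -
    have c: "a \<in> carrier M" "b \<in> carrier M" "c \<in> carrier M" using abc sub by auto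
    have "a \<otimes> (g \<otimes> h) = (a \<otimes> g) \<otimes> h" using c g(1) h(1) m_assoc by simp
    also have "\<dots> = g \<otimes> (b \<otimes> h)" using c g(1) h(1) m_assoc e by simp
    also have "\<dots> = (g \<otimes> h) \<otimes> c" using c g(1) h(1) m_assoc e by simp
    finally show ?thesis .
  qed
  show ?thesis
    unfolding intertwines_def
  proof (intro conjI ballI)
    show "g \<otimes> h \<in> carrier M" using g(1) h(1) by simp
    show "\<exists>c\<in>C. a \<otimes> (g \<otimes> h) = g \<otimes> h \<otimes> c" if "a \<in> A" for a
      using g(2)[OF that] h(2) comp[OF that] by blast
    show "\<exists>a\<in>A. a \<otimes> (g \<otimes> h) = g \<otimes> h \<otimes> c" if "c \<in> C" for c
      using h(3)[OF that] g(3) comp[OF _ _ that] by blast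
  qed
qed

text \<open>When \<open>d\<close> intertwines \<open>R\<close> with itself, conjugation by \<open>d\<close> is an automorphism of \<open>R\<close>. It
  moves a parabolic \<open>P \<subseteq> R\<close> to a parabolic of \<open>M\<close>: heads for the image are computed by taking the
  \<open>R\<close>-head first and carrying the \<open>P\<close>-head over.\<close>

lemma conjugate_parabolic:
  assumes R: "standard_parabolic M R" and P: "standard_parabolic M P" and PR: "P \<subseteq> R"
    and d: "intertwines d R R"
  shows "standard_parabolic M {w \<in> R. \<exists>p\<in>P. p \<otimes> d = d \<otimes> w}" (is "standard_parabolic M ?W")
proof -
  note dc = intertwinesD(1)[OF d]
  note Rc = parabolic_subset[OF R]
  obtain \<phi> where \<phi>: "\<And>x. x \<in> R \<Longrightarrow> \<phi> x \<in> R" "\<And>x. x \<in> R \<Longrightarrow> x \<otimes> d = d \<otimes> \<phi> x"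
    using intertwinesD(2)[OF d] by metis
  obtain \<psi> where \<psi>: "\<And>x. x \<in> R \<Longrightarrow> \<psi> x \<in> R" "\<And>x. x \<in> R \<Longrightarrow> \<psi> x \<otimes> d = d \<otimes> x"
    using intertwinesD(3)[OF d] by metis
  have \<phi>\<psi>: "\<phi> (\<psi> x) = x" if "x \<in> R" for x
    using \<phi>[of "\<psi> x"] \<psi>[of x] that Rc dc l_cancel[of d "\<phi> (\<psi> x)" x] by metis
  have \<psi>\<phi>: "\<psi> (\<phi> x) = x" if "x \<in> R" for x
    using \<psi>[of "\<phi> x"] \<phi>[of x] that Rc dc r_cancel[of "\<psi> (\<phi> x)" d x] by metis
  have \<phi>m: "\<phi> (x \<otimes> y) = \<phi> x \<otimes> \<phi> y" if "x \<in> R" "y \<in> R" for x y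
  proof -
    have xy: "x \<otimes> y \<in> R" using parabolic_mult[OF R] that by blast
    have "d \<otimes> \<phi> (x \<otimes> y) = d \<otimes> (\<phi> x \<otimes> \<phi> y)"
      using conj_mult[of x y "\<phi> x" "\<phi> y" d] \<phi> that Rc dc xy by metis
    then show ?thesis using that xy \<phi>(1) Rc dc l_cancel m_closed by metis
  qed
  have \<psi>m: "\<psi> (x \<otimes> y) = \<psi> x \<otimes> \<psi> y" if "x \<in> R" "y \<in> R" for x y
    using \<phi>m[of "\<psi> x" "\<psi> y"] that \<psi>(1) \<phi>\<psi> \<psi>\<phi> parabolic_mult[OF R] by metis
  have \<phi>d: "\<phi> x divides \<phi> y" if xy: "x \<in> R" "y \<in> R" "x divides y" for x y
  proof -
    obtain z where z: "z \<in> carrier M" "y = x \<otimes> z" using xy(3) by (auto simp: factor_def)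
    then have "z \<in> R" using parabolic_of_mult(2)[OF R] xy Rc by blast
    then have "\<phi> y = \<phi> x \<otimes> \<phi> z" "\<phi> z \<in> carrier M" using \<phi>m z xy \<phi>(1) Rc by auto
    then show ?thesis by (auto simp: factor_def)
  qed
  have \<psi>d: "\<psi> x divides \<psi> y" if xy: "x \<in> R" "y \<in> R" "x divides y" for x y
  proof -
    obtain z where z: "z \<in> carrier M" "y = x \<otimes> z" using xy(3) by (auto simp: factor_def)
    then have "z \<in> R" using parabolic_of_mult(2)[OF R] xy Rc by blast
    then have "\<psi> y = \<psi> x \<otimes> \<psi> z" "\<psi> z \<in> carrier M" using \<psi>m z xy \<psi>(1) Rc by auto
    then show ?thesis by (auto simp: factor_def)
  qed
  have \<phi>r: "right_divides M (\<phi> x) (\<phi> y)" if xy: "x \<in> R" "y \<in> R" "right_divides M x y" for x y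
  proof -
    obtain z where z: "z \<in> carrier M" "y = z \<otimes> x" using xy(3) by (auto simp: right_divides_def)
    then have "z \<in> R" using parabolic_of_mult(1)[OF R] xy Rc by blast
    then have "\<phi> y = \<phi> z \<otimes> \<phi> x" "\<phi> z \<in> carrier M" using \<phi>m z xy \<phi>(1) Rc by auto
    then show ?thesis by (auto simp: right_divides_def)
  qed
  have \<psi>r: "right_divides M (\<psi> x) (\<psi> y)" if xy: "x \<in> R" "y \<in> R" "right_divides M x y" for x y
  proof -
    obtain z where z: "z \<in> carrier M" "y = z \<otimes> x" using xy(3) by (auto simp: right_divides_def)
    then have "z \<in> R" using parabolic_of_mult(1)[OF R] xy Rc by blast
    then have "\<psi> y = \<psi> z \<otimes> \<psi> x" "\<psi> z \<in> carrier M" using \<psi>m z xy \<psi>(1) Rc by auto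
    then show ?thesis by (auto simp: right_divides_def)
  qed
  have W: "w \<in> ?W \<longleftrightarrow> w \<in> R \<and> \<psi> w \<in> P" for w
  proof
    assume "w \<in> ?W"
    then obtain p where p: "p \<in> P" "p \<otimes> d = d \<otimes> w" "w \<in> R" by blast
    then have "\<psi> w = p"
      using \<psi>[of w] PR Rc dc r_cancel[of "\<psi> w" d p] by (metis subsetD)
    then show "w \<in> R \<and> \<psi> w \<in> P" using p by simp
  qed (use \<psi> in blast)
  show ?thesis
    unfolding standard_parabolic_def
  proof (intro conjI ballI allI impI)
    show "submonoid ?W M"
    proof
      show "?W \<subseteq> carrier M" using Rc by blast
      show "\<one> \<in> ?W" using parabolic_one[OF R] parabolic_one[OF P] dc by (auto intro!: bexI[of _ \<one>])
      show "x \<otimes> y \<in> ?W" if "x \<in> ?W" "y \<in> ?W" for x y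
        using that \<psi>m parabolic_mult[OF R] parabolic_mult[OF P] unfolding W by metis
    qed
  next
    fix x a assume x: "x \<in> ?W" and a: "is_factor M a x"
    obtain u v where uv: "u \<in> carrier M" "a \<in> carrier M" "v \<in> carrier M" "x = u \<otimes> (a \<otimes> v)"
      using a by (elim factorE)
    have xR: "u \<otimes> (a \<otimes> v) \<in> R" using x uv by auto
    then have uR: "u \<in> R" "a \<otimes> v \<in> R" using parabolic_of_mult[OF R xR] uv by auto
    then have vR: "a \<in> R" "v \<in> R" using parabolic_of_mult[OF R uR(2)] uv by auto
    have "\<psi> x = \<psi> u \<otimes> (\<psi> a \<otimes> \<psi> v)" using \<psi>m uR vR uv by simp
    then have "is_factor M (\<psi> a) (\<psi> x)"
      using factorI \<psi>(1) uR vR Rc by metis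
    then have "\<psi> a \<in> P" using parabolic_factor[OF P] x W by blast
    then show "a \<in> ?W" using W vR by blast
  next
    fix g assume g: "g \<in> carrier M"
    note h = headD[OF R g]
    have hc: "\<psi> (head M R g) \<in> R" "\<psi> (head M R g) \<in> carrier M" using \<psi>(1) h(1) Rc by auto
    note k = headD[OF P hc(2)]
    let ?k = "head M P (\<psi> (head M R g))"
    have kR: "?k \<in> R" using k(1) PR by blast
    have "is_head M ?W g (\<phi> ?k)"
      unfolding is_head_def
    proof (intro conjI ballI impI)
      show "\<phi> ?k \<in> ?W" using W \<phi>(1) \<psi>\<phi> kR k(1) by simp
      have "\<phi> ?k divides head M R g" using \<phi>d[OF kR hc(1) k(3)] \<phi>\<psi> h(1) by simp
      then show "\<phi> ?k divides g" using h(3) \<phi>(1) kR Rc divides_trans by blast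
      fix y assume y: "y \<in> ?W" "y divides g"
      then have yR: "y \<in> R" "\<psi> y \<in> P" using W by auto
      have "y divides head M R g" using h(4)[OF yR(1) y(2)] .
      then have "\<psi> y divides ?k" using k(4)[OF yR(2)] \<psi>d[OF yR(1) h(1)] by blast
      then show "y divides \<phi> ?k" using \<phi>d[of "\<psi> y" ?k] \<phi>\<psi> yR kR \<psi>(1) by simp
    qed
    then show "\<exists>h. is_head M ?W g h" by blast
    obtain h where h: "is_right_head M R g h"
      using R g by (auto simp: standard_parabolic_def)
    then have hR: "h \<in> R" "\<psi> h \<in> R" "\<psi> h \<in> carrier M" using \<psi>(1) Rc by (auto simp: is_right_head_def)
    obtain k where k: "is_right_head M P (\<psi> h) k"
      using P hR(3) by (auto simp: standard_parabolic_def)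
    then have kR: "k \<in> P" "k \<in> R" using PR by (auto simp: is_right_head_def)
    have "is_right_head M ?W g (\<phi> k)"
      unfolding is_right_head_def
    proof (intro conjI ballI impI)
      show "\<phi> k \<in> ?W" using W \<phi>(1) \<psi>\<phi> kR by simp
      have "right_divides M (\<phi> k) h"
        using \<phi>r[OF kR(2) hR(2)] k \<phi>\<psi> hR(1) by (simp add: is_right_head_def)
      then show "right_divides M (\<phi> k) g"
        using h right_divides_trans \<phi>(1) kR Rc unfolding is_right_head_def by blast
      fix y assume y: "y \<in> ?W" "right_divides M y g"
      then have yR: "y \<in> R" "\<psi> y \<in> P" using W by auto
      have "right_divides M y h" using h yR(1) y(2) by (simp add: is_right_head_def)
      then have "right_divides M (\<psi> y) k"
        using k yR(2) \<psi>r[OF yR(1) hR(1)] by (simp add: is_right_head_def)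
      then show "right_divides M y (\<phi> k)" using \<phi>r[of "\<psi> y" k] \<phi>\<psi> yR kR \<psi>(1) by simp
    qed
    then show "\<exists>h. is_right_head M ?W g h" by blast
  qed
qed

text \<open>A conjugate of a power of \<open>\<delta> P\<close> by an element of \<open>P\<close> need not be a power of \<open>\<delta> P\<close>, and a
  conjugate of \<open>\<delta> P\<close> in another parabolic is not known in advance to be its Garside element.
  Fullness is what survives in both situations.\<close>

definition full :: "'a set \<Rightarrow> 'a \<Rightarrow> bool" where
  "full P b \<longleftrightarrow> b \<in> P \<and> (\<forall>p\<in>P. \<exists>j::nat. p divides b [^] j)"

lemma full_transport:
  assumes P: "standard_parabolic M P" and Q: "Q \<subseteq> carrier M"
    and g: "intertwines g P Q" and b: "full P b" and c: "c \<in> Q" "b \<otimes> g = g \<otimes> c"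
  shows "full Q c"
  unfolding full_def
proof (intro conjI ballI)
  fix w assume w: "w \<in> Q"
  note gc = intertwinesD(1)[OF g]
  obtain p where p: "p \<in> P" "p \<otimes> g = g \<otimes> w" using intertwinesD(3)[OF g w] by blast
  obtain j :: nat and x where x: "x \<in> carrier M" "b [^] j = p \<otimes> x"
    using b p by (auto simp: full_def factor_def)
  have bP: "b \<in> P" using b by (simp add: full_def)
  have "x \<in> P"
    using parabolic_of_mult(2)[OF P _ _ x(1), of p] x parabolic_pow[OF P bP, of j] parabolic_subset[OF P p(1)]
    by simp
  then obtain v where v: "v \<in> Q" "x \<otimes> g = g \<otimes> v" using intertwinesD(2)[OF g] by blast
  have "g \<otimes> c [^] j = g \<otimes> (w \<otimes> v)"
    using conj_pow[of b c g j] conj_mult[of p x w v g] p v x w c gc subsetD[OF Q]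
      parabolic_subset[OF P] bP by auto
  then have "c [^] j = w \<otimes> v"
    using l_cancel gc c w v Q by (meson m_closed nat_pow_closed subsetD)
  then show "\<exists>j::nat. w divides c [^] j"
    using v Q by (auto simp: factor_def)
qed (rule c(1))

end

section \<open>Garside monoids in which lcms of atoms are parabolic\<close>

locale lcm_garside_monoid = garside_monoid +
  assumes atoms_lcm: "S1 \<subseteq> atoms M \<Longrightarrow>
    is_right_lcm_of_set M (head M (parabolic_closure M S1) \<Delta>) S1"
begin

lemma delta_lcm:
  assumes "standard_parabolic M P"
  shows "is_right_lcm_of_set M (\<delta> P) (atoms M \<inter> P)"
  using atoms_lcm[of "atoms M \<inter> P"] closure_atoms[OF assms] by simp

text \<open>Conjugation by \<open>\<delta> P\<close> permutes the divisors of \<open>\<delta> P\<close>; these contain the atoms of \<open>P\<close>, which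
  generate \<open>P\<close>.\<close>

lemma delta_intertwines:
  assumes P: "standard_parabolic M P"
  shows "intertwines (\<delta> P) P P"
  unfolding intertwines_def
proof (intro conjI ballI)
  note d = delta_closed(2)[OF P]
  have sd: "s divides \<delta> P" if "s \<in> atoms M" "s \<in> P" for s
    using delta_lcm[OF P] that by (auto simp: is_right_lcm_of_set_def)
  have div: "y \<in> P" if "y \<in> carrier M" "y divides \<delta> P" for y
    using parabolic_divides[OF P delta_closed(1)[OF P] that] .
  show "\<exists>q\<in>P. p \<otimes> \<delta> P = \<delta> P \<otimes> q" if "p \<in> P" for p
    using P that
  proof (induction p rule: parabolic_atom_induct)
    case one
    then show ?case using parabolic_one[OF P] d by (intro bexI[of _ \<one>]) auto
  next
    case (mult s x)
    then obtain q where q: "q \<in> P" "x \<otimes> \<delta> P = \<delta> P \<otimes> q" by blast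
    obtain t where t: "t \<in> P" "s \<otimes> \<delta> P = \<delta> P \<otimes> t"
      using delta_twist(1)[OF P _ sd] mult div parabolic_subset[OF P] by meson
    show ?case
      using conj_mult[of s x t q "\<delta> P"] mult q t parabolic_subset[OF P] d parabolic_mult[OF P]
      by (intro bexI[of _ "t \<otimes> q"]) auto
  qed
  show "\<exists>p\<in>P. p \<otimes> \<delta> P = \<delta> P \<otimes> q" if "q \<in> P" for q
    using P that
  proof (induction q rule: parabolic_atom_induct)
    case one
    then show ?case using parabolic_one[OF P] d by (intro bexI[of _ \<one>]) auto
  next
    case (mult s x)
    then obtain p where p: "p \<in> P" "p \<otimes> \<delta> P = \<delta> P \<otimes> x" by blast
    obtain t where t: "t \<in> P" "t \<otimes> \<delta> P = \<delta> P \<otimes> s"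
      using delta_twist(2)[OF P _ sd] mult div parabolic_subset[OF P] by metis
    show ?case
      using conj_mult[of t p s x "\<delta> P"] mult p t parabolic_subset[OF P] d parabolic_mult[OF P]
      by (intro bexI[of _ "t \<otimes> p"]) auto
  qed
qed (rule delta_closed(2)[OF P])

lemma divides_delta_pow:
  assumes P: "standard_parabolic M P" and "p \<in> P"
  shows "\<exists>j::nat. p divides \<delta> P [^] j"
  using assms
proof (induction p rule: parabolic_atom_induct)
  case one
  then show ?case by (intro exI[of _ 0]) (auto simp: factor_def)
next
  case (mult s x)
  note d = delta_closed(2)[OF P]
  have s: "s \<in> carrier M" "s divides \<delta> P"
    using delta_lcm[OF P] mult by (auto simp: is_right_lcm_of_set_def atom_iff)
  have x: "x \<in> carrier M" using mult parabolic_subset[OF P] by blast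
  obtain j :: nat and z where z: "z \<in> carrier M" "\<delta> P [^] j = x \<otimes> z"
    using mult by (auto simp: factor_def)
  obtain y where y: "y \<in> carrier M" "y divides \<delta> P" "s \<otimes> \<delta> P [^] j = \<delta> P [^] j \<otimes> y"
    using delta_pow_twist[OF P s] by blast
  obtain w where w: "w \<in> carrier M" "\<delta> P = y \<otimes> w" using y by (auto simp: factor_def)
  have "\<delta> P [^] Suc j = \<delta> P [^] j \<otimes> (y \<otimes> w)" using w(2) by simp
  also have "\<dots> = (s \<otimes> \<delta> P [^] j) \<otimes> w" using y w d m_assoc by simp
  also have "\<dots> = (s \<otimes> x) \<otimes> (z \<otimes> w)" unfolding z(2) using s x z(1) w(1) m_assoc by simp
  finally show ?case using z w unfolding factor_def by (metis m_closed)
qed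

lemma delta_pow_full:
  assumes P: "standard_parabolic M P" and k: "k > 0"
  shows "full P (\<delta> P [^] (k::nat))"
  unfolding full_def
proof (intro conjI ballI)
  note d = delta_closed(2)[OF P]
  fix p assume p: "p \<in> P"
  obtain j :: nat where j: "p divides \<delta> P [^] j" using divides_delta_pow[OF P p] by blast
  have "\<delta> P [^] (k * j) = \<delta> P [^] j \<otimes> \<delta> P [^] (k * j - j)"
    using k d by (simp add: nat_pow_mult)
  then have "\<delta> P [^] j divides (\<delta> P [^] k) [^] j"
    using d by (auto simp: factor_def nat_pow_pow)
  then show "\<exists>j::nat. p divides (\<delta> P [^] k) [^] j"
    using j parabolic_subset[OF P p] divides_trans by blast
qed (use parabolic_pow[OF P] delta_closed[OF P] in blast)

text \<open>These are the pieces of which a ribbon is composed. Let \<open>R\<close> be the parabolic closure of \<open>P\<close> and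
  \<open>t\<close>, and let \<open>\<delta> R = \<delta> P \<otimes> r\<close>. Conjugation by \<open>\<delta> P\<close> preserves \<open>P\<close>, and conjugation by \<open>\<delta> R\<close>
  carries it to a parabolic \<open>P' \<subseteq> R\<close>, hence conjugation by \<open>r\<close> carries \<open>P\<close> to \<open>P'\<close>. As \<open>r\<close> has no
  right divisor in \<open>P'\<close> except \<open>\<one>\<close>, the element \<open>p \<otimes> r = r \<otimes> p'\<close> is the lcm of \<open>p\<close> and \<open>r\<close>, so \<open>r\<close>
  divides \<open>g\<close> as soon as it divides \<open>p \<otimes> g\<close>. That the lcm of \<open>t\<close> and the atoms of \<open>P\<close> is \<open>\<delta> R\<close>
  enters in the last clause.\<close>

lemma elementary_ribbon:
  assumes P: "standard_parabolic M P" and t: "t \<in> atoms M" "t \<notin> P"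
  obtains r P' where "standard_parabolic M P'" "intertwines r P P'" "r \<noteq> \<one>"
    "\<And>p g. p \<in> P \<Longrightarrow> g \<in> carrier M \<Longrightarrow> r divides p \<otimes> g \<Longrightarrow> r divides g"
    "\<And>x. x \<in> carrier M \<Longrightarrow> \<delta> P divides x \<Longrightarrow> t divides x \<Longrightarrow> \<delta> P \<otimes> r divides x"
proof -
  let ?S = "insert t (atoms M \<inter> P)"
  define R where "R = parabolic_closure M ?S"
  have S: "?S \<subseteq> atoms M" "?S \<subseteq> carrier M" using t by (auto simp: atom_iff)
  have R: "standard_parabolic M R" unfolding R_def using closure_parabolic[OF S(2)] .
  have SR: "?S \<subseteq> R" unfolding R_def by (rule closure_superset)
  have PR: "P \<subseteq> R"
    using closure_least[OF R, of "atoms M \<inter> P"] SR closure_atoms[OF P] by blast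
  have lcm: "is_right_lcm_of_set M (\<delta> R) ?S"
    unfolding R_def by (rule atoms_lcm[OF S(1)])
  note dR = delta_closed[OF R] and dP = delta_closed[OF P]
  note Rc = parabolic_subset[OF R] and Pc = parabolic_subset[OF P]
  have "\<delta> P divides \<delta> R"
    using divides_delta_iff[OF R] headD(3)[OF P Delta_closed] dP PR by blast
  then obtain r where r: "r \<in> carrier M" "\<delta> R = \<delta> P \<otimes> r" by (auto simp: factor_def)
  have Rint: "intertwines (\<delta> R) R R" and Pint: "intertwines (\<delta> P) P P"
    using delta_intertwines R P by auto
  define P' where "P' = {w \<in> R. \<exists>p\<in>P. p \<otimes> \<delta> R = \<delta> R \<otimes> w}"
  have P': "standard_parabolic M P'"
    unfolding P'_def by (rule conjugate_parabolic[OF R P PR Rint])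
  note P'c = parabolic_subset[OF P']
  have shift: "p \<otimes> r = r \<otimes> w"
    if "p0 \<in> carrier M" "p \<in> carrier M" "w \<in> carrier M"
      and e: "p0 \<otimes> \<delta> P = \<delta> P \<otimes> p" "p0 \<otimes> \<delta> R = \<delta> R \<otimes> w" for p0 p w
  proof -
    have "\<delta> P \<otimes> (p \<otimes> r) = (p0 \<otimes> \<delta> P) \<otimes> r" using that(1-3) dP r(1) m_assoc e(1) by simp
    also have "\<dots> = p0 \<otimes> \<delta> R" using that(1-3) dP r m_assoc by simp
    also have "\<dots> = \<delta> P \<otimes> (r \<otimes> w)" using that(1-3) dP r m_assoc e(2) by simp
    finally show ?thesis using l_cancel dP(2) r(1) that(1-3) by (meson m_closed)
  qed
  have rint: "intertwines r P P'"
    unfolding intertwines_def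
  proof (intro conjI ballI)
    fix p assume p: "p \<in> P"
    obtain p0 where p0: "p0 \<in> P" "p0 \<otimes> \<delta> P = \<delta> P \<otimes> p" using intertwinesD(3)[OF Pint p] by blast
    obtain w where w: "w \<in> R" "p0 \<otimes> \<delta> R = \<delta> R \<otimes> w" using intertwinesD(2)[OF Rint] p0(1) PR by blast
    have "w \<in> P'" using w p0 by (auto simp: P'_def)
    then show "\<exists>w\<in>P'. p \<otimes> r = r \<otimes> w" using shift[OF _ _ _ p0(2) w(2)] p p0 Pc P'c by blast
  next
    fix w assume w: "w \<in> P'"
    then obtain p0 where p0: "p0 \<in> P" "p0 \<otimes> \<delta> R = \<delta> R \<otimes> w" by (auto simp: P'_def)
    obtain p where p: "p \<in> P" "p0 \<otimes> \<delta> P = \<delta> P \<otimes> p" using intertwinesD(2)[OF Pint p0(1)] by blast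
    then show "\<exists>p\<in>P. p \<otimes> r = r \<otimes> w" using shift[OF _ _ _ p(2) p0(2)] p p0 Pc P'c w by blast
  qed (rule r(1))
  have rne: "r \<noteq> \<one>"
  proof
    assume "r = \<one>"
    then have "\<delta> R = \<delta> P" using r dP by simp
    then have "t divides \<delta> P" using lcm by (auto simp: is_right_lcm_of_set_def)
    then show False using parabolic_divides[OF P dP(1)] t by (auto simp: atom_iff)
  qed
  \<comment> \<open>A right divisor \<open>c \<in> P'\<close> of \<open>r\<close> corresponds to \<open>p0 \<in> P\<close> with \<open>p0 \<otimes> \<delta> P\<close> a right divisor of
    \<open>\<delta> R\<close>. But \<open>\<delta> P\<close> is already the greatest right divisor of \<open>\<delta> R\<close> in \<open>P\<close>.\<close>
  have reduced: "c = \<one>" if c: "c \<in> P'" and h: "h \<in> carrier M" "r = h \<otimes> c" for c h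
  proof -
    have cc: "c \<in> carrier M" using c P'c by blast
    obtain d' where d': "d' \<in> P'" "\<delta> P \<otimes> r = r \<otimes> d'"
      using intertwinesD(2)[OF rint dP(1)] by blast
    have d'c: "d' \<in> carrier M" using d' P'c by blast
    have dRe: "\<delta> R = h \<otimes> (c \<otimes> d')" using r d' h cc d'c m_assoc by simp
    obtain p0 where p0: "p0 \<in> P" "p0 \<otimes> \<delta> R = \<delta> R \<otimes> c" using c by (auto simp: P'_def)
    have p0c: "p0 \<in> carrier M" using p0 Pc by blast
    have "h \<in> R"
      using parabolic_of_mult(1)[OF R, of h "c \<otimes> d'"] dR dRe h cc d'c by simp
    then obtain h0 where h0: "h0 \<in> R" "h0 \<otimes> \<delta> R = \<delta> R \<otimes> h" using intertwinesD(3)[OF Rint] by blast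
    have h0c: "h0 \<in> carrier M" using h0 Rc by blast
    have dd: "\<delta> P \<otimes> \<delta> R = \<delta> R \<otimes> d'"
    proof -
      have "\<delta> P \<otimes> \<delta> R = \<delta> P \<otimes> (r \<otimes> d')" unfolding r(2) d'(2) ..
      also have "\<dots> = \<delta> R \<otimes> d'" unfolding r(2) using r(1) dP d'c m_assoc by simp
      finally show ?thesis .
    qed
    have "\<delta> R \<otimes> \<delta> R = \<delta> R \<otimes> (h \<otimes> (c \<otimes> d'))" using dRe by simp
    also have "\<dots> = (h0 \<otimes> \<delta> R) \<otimes> (c \<otimes> d')" using dR h cc d'c m_assoc h0 by simp
    also have "\<dots> = h0 \<otimes> ((\<delta> R \<otimes> c) \<otimes> d')" using dR h0c cc d'c m_assoc by simp
    also have "\<dots> = h0 \<otimes> (p0 \<otimes> (\<delta> R \<otimes> d'))" unfolding p0(2)[symmetric] using dR p0c d'c m_assoc by simp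
    also have "\<dots> = (h0 \<otimes> (p0 \<otimes> \<delta> P)) \<otimes> \<delta> R"
      unfolding dd[symmetric] using dR h0c p0c dP m_assoc by simp
    finally have "\<delta> R = h0 \<otimes> (p0 \<otimes> \<delta> P)"
      using r_cancel dR(2) h0c p0c dP(2) by (meson m_closed)
    then have "right_divides M (p0 \<otimes> \<delta> P) (\<delta> R)" using h0c by (auto simp: right_divides_def)
    moreover have pd: "p0 \<otimes> \<delta> P \<in> P" using parabolic_mult[OF P p0(1) dP(1)] .
    ultimately have "right_divides M (p0 \<otimes> \<delta> P) (\<delta> P)"
      using right_divides_delta_iff[OF R] right_divides_delta_iff[OF P] PR by blast
    then have "is_factor M (p0 \<otimes> \<delta> P) (\<delta> P)"
      using right_divides_imp_factor pd Pc dP by blast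
    moreover have "is_factor M (\<delta> P) (p0 \<otimes> \<delta> P)"
      using p0c dP(2) by (intro right_divides_imp_factor) (auto simp: right_divides_def)
    ultimately have "p0 \<otimes> \<delta> P = \<delta> P" by (rule factor_antisym)
    then have "p0 = \<one>" using eq_mult_left_imp_one dP p0c by blast
    then have "\<delta> R \<otimes> c = \<delta> R" using p0(2) dR by simp
    then show "c = \<one>" using eq_mult_right_imp_one dR cc by blast
  qed
  \<comment> \<open>The lcm \<open>m\<close> of \<open>p\<close> and \<open>r\<close> divides \<open>p \<otimes> r\<close>, and the quotient \<open>c\<close> is a right divisor of \<open>r\<close>
    lying in \<open>P'\<close>.\<close>
  have cancel: "r divides g" if p: "p \<in> P" and g: "g \<in> carrier M" and rd: "r divides p \<otimes> g" for p g
  proof -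
    have pc: "p \<in> carrier M" using p Pc by blast
    obtain q where q: "q \<in> P'" "p \<otimes> r = r \<otimes> q" using intertwinesD(2)[OF rint p] by blast
    have qc: "q \<in> carrier M" using q P'c by blast
    obtain m where m: "m \<in> carrier M" "m lcmof p r" using right_lcm_exists[OF pc r(1)] by blast
    obtain h u where hu: "h \<in> carrier M" "u \<in> carrier M" "m = p \<otimes> h" "m = r \<otimes> u"
      using m by (auto simp: islcm_def factor_def)
    have "r divides p \<otimes> r" using q qc by (auto simp: factor_def)
    then have "m divides p \<otimes> r"
      using m pc r by (auto simp: islcm_def)
    then obtain c where c: "c \<in> carrier M" "p \<otimes> r = m \<otimes> c" by (auto simp: factor_def)
    have "p \<otimes> r = p \<otimes> (h \<otimes> c)" using c hu pc m_assoc by simp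
    then have rh: "r = h \<otimes> c" using l_cancel pc r(1) hu c by (meson m_closed)
    have "r \<otimes> q = m \<otimes> c" unfolding q(2)[symmetric] by (rule c(2))
    also have "\<dots> = r \<otimes> (u \<otimes> c)" unfolding hu(4) using c(1) hu(2) r(1) m_assoc by simp
    finally have "q = u \<otimes> c" using l_cancel r(1) hu c qc by (meson m_closed)
    then have "c \<in> P'" using parabolic_of_mult(2)[OF P' _ hu(2) c(1)] q by simp
    then have "c = \<one>" using reduced hu rh by blast
    then have "h = r" using rh hu by simp
    moreover have "m divides p \<otimes> g" using m rd pc g by (auto simp: islcm_def)
    ultimately show "r divides g" using hu pc r(1) g by (simp add: divides_mult_l)
  qed
  have last: "\<delta> P \<otimes> r divides x" if x: "x \<in> carrier M" "\<delta> P divides x" "t divides x" for x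
  proof -
    have "s divides x" if "s \<in> ?S" for s
      using that x delta_lcm[OF P] divides_trans[of s "\<delta> P" x] by (auto simp: is_right_lcm_of_set_def atom_iff)
    then show ?thesis using lcm x r by (auto simp: is_right_lcm_of_set_def)
  qed
  show thesis by (rule that[OF P' rint rne cancel last])
qed

text \<open>The element \<open>g\<close> is decomposed into elementary ribbons by Noetherian induction. What makes
  the first ribbon \<open>r\<close> divide \<open>g\<close> is that some \<open>b\<^sup>j g = g c\<^sup>j\<close> is divisible both by \<open>\<delta> P\<close>, because \<open>b\<close>
  is full, and by any atom \<open>t\<close> dividing \<open>g\<close>.\<close>

lemma full_conj_intertwines:
  assumes Q: "standard_parabolic M Q" and c: "full Q c"
  shows "\<lbrakk>g \<in> carrier M; standard_parabolic M P; full P b; b \<otimes> g = g \<otimes> c;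
    \<And>y. y \<in> P \<Longrightarrow> y divides g \<Longrightarrow> y = \<one>\<rbrakk> \<Longrightarrow> intertwines g P Q"
proof (induction g arbitrary: P b rule: wf_induct_rule[OF proper_factor_wf])
  case (1 g)
  note g = 1(2) and P = 1(3) and b = 1(4) and bg = 1(5) and red = 1(6)
  note Pc = parabolic_subset[OF P] and Qc = parabolic_subset[OF Q]
  have bP: "b \<in> P" and cQ: "c \<in> Q" using b c by (auto simp: full_def)
  have bc: "b \<in> carrier M" and cc: "c \<in> carrier M" using bP cQ Pc Qc by auto
  show ?case
  proof (cases "g = \<one>")
    case True
    then have "b = c" using bg bc cc by simp
    have "P \<subseteq> Q"
    proof
      fix p assume p: "p \<in> P"
      then obtain j :: nat where "p divides c [^] j" using b \<open>b = c\<close> by (auto simp: full_def)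
      then show "p \<in> Q" using parabolic_divides[OF Q parabolic_pow[OF Q cQ]] p Pc by blast
    qed
    moreover have "Q \<subseteq> P"
    proof
      fix q assume q: "q \<in> Q"
      then obtain j :: nat where "q divides b [^] j" using c \<open>b = c\<close> by (auto simp: full_def)
      then show "q \<in> P" using parabolic_divides[OF P parabolic_pow[OF P bP]] q Qc by blast
    qed
    ultimately show ?thesis using True Pc by (auto simp: intertwines_def)
  next
    case False
    then obtain t where t: "t \<in> atoms M" "t divides g" using atom_divides_exists[OF g] by blast
    then have tP: "t \<notin> P" using red by (auto simp: atom_iff)
    obtain r P' where P': "standard_parabolic M P'" and rint: "intertwines r P P'" and rne: "r \<noteq> \<one>"
      and cancel: "\<And>p g. p \<in> P \<Longrightarrow> g \<in> carrier M \<Longrightarrow> r divides p \<otimes> g \<Longrightarrow> r divides g"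
      and lcm: "\<And>x. x \<in> carrier M \<Longrightarrow> \<delta> P divides x \<Longrightarrow> t divides x \<Longrightarrow> \<delta> P \<otimes> r divides x"
      by (rule elementary_ribbon[OF P t(1) tP]) (rule that, assumption+)
    note r = intertwinesD[OF rint] and P'c = parabolic_subset[OF P']
    note dP = delta_closed[OF P]
    obtain j :: nat where "\<delta> P divides b [^] j" using b dP by (auto simp: full_def)
    then obtain p1 where p1: "p1 \<in> carrier M" "b [^] j = \<delta> P \<otimes> p1" by (auto simp: factor_def)
    then have p1P: "p1 \<in> P"
      using parabolic_of_mult(2)[OF P _ dP(2) p1(1)] parabolic_pow[OF P bP, of j] by simp
    have e: "b [^] j \<otimes> g = g \<otimes> c [^] j" using conj_pow[OF bc cc g bg] .
    have "t divides b [^] j \<otimes> g"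
      unfolding e using t g cc divides_prod_r by (auto simp: atom_iff)
    moreover have e1: "b [^] j \<otimes> g = \<delta> P \<otimes> (p1 \<otimes> g)" using p1 dP g m_assoc by simp
    then have "\<delta> P divides b [^] j \<otimes> g" using p1 g by (auto simp: factor_def)
    ultimately have "\<delta> P \<otimes> r divides \<delta> P \<otimes> (p1 \<otimes> g)" using lcm[of "b [^] j \<otimes> g"] p1(1) dP g e1 by simp
    then have "r divides p1 \<otimes> g" using dP r(1) p1 g by (simp add: divides_mult_l)
    then have "r divides g" using cancel[OF p1P g] by blast
    then obtain g1 where g1: "g1 \<in> carrier M" "g = r \<otimes> g1" by (auto simp: factor_def)
    obtain b' where b': "b' \<in> P'" "b \<otimes> r = r \<otimes> b'" using r(2)[OF bP] by blast
    have b'c: "b' \<in> carrier M" using b' P'c by blast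
    have full': "full P' b'"
      using full_transport[OF P _ rint b b'] P'c by blast
    have "r \<otimes> (b' \<otimes> g1) = (b \<otimes> r) \<otimes> g1" using b' b'c g1(1) r(1) m_assoc by simp
    also have "\<dots> = r \<otimes> (g1 \<otimes> c)" using bg g1 bc cc r(1) m_assoc by simp
    finally have bg': "b' \<otimes> g1 = g1 \<otimes> c" using l_cancel r(1) g1(1) b'c cc by (meson m_closed)
    have red': "y = \<one>" if y: "y \<in> P'" "y divides g1" for y
    proof -
      have yc: "y \<in> carrier M" using y P'c by blast
      obtain x where x: "x \<in> P" "x \<otimes> r = r \<otimes> y" using r(3)[OF y(1)] by blast
      have xc: "x \<in> carrier M" using x Pc by blast
      have "x \<otimes> r divides g" using x(2) g1 y yc r(1) by (simp add: divides_mult_l)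
      moreover have "x divides x \<otimes> r" using r(1) by (auto simp: factor_def)
      ultimately have "x divides g" using xc divides_trans by blast
      then have "x = \<one>" using red x by blast
      then have "r \<otimes> y = r" using x(2) r(1) by simp
      then show "y = \<one>" using eq_mult_right_imp_one r(1) yc by blast
    qed
    have "right_divides M g1 g" using g1 r(1) by (auto simp: right_divides_def)
    then have "is_factor M g1 g" using right_divides_imp_factor g1 g by blast
    moreover have "g1 \<noteq> g" using eq_mult_left_imp_one[OF g1(1) r(1)] g1(2) rne by auto
    ultimately have "is_proper_factor M g1 g" by (auto simp: is_proper_factor_def)
    then have "intertwines g1 P' Q"
      using 1(1)[of g1 P' b'] g1(1) g P' full' bg' red' by blast
    then have "intertwines (r \<otimes> g1) P Q"
      using intertwines_comp[OF rint] Pc P'c Qc by blast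
    then show ?thesis using g1(2) by simp
  qed
qed

text \<open>The \<open>P\<close>-head \<open>p\<close> of \<open>g\<close> can be dropped: as \<open>p\<close> divides \<open>b \<otimes> g\<close>, whose \<open>P\<close>-head is \<open>b \<otimes> p\<close>,
  the conjugate of \<open>b\<close> by \<open>p\<close> stays in \<open>P\<close>, and it is again full.\<close>

lemma full_conj_reduced_intertwines:
  assumes P: "standard_parabolic M P" and Q: "standard_parabolic M Q"
    and b: "full P b" and c: "full Q c" and g: "g \<in> carrier M" and bg: "b \<otimes> g = g \<otimes> c"
  shows "\<exists>g'. (\<forall>y\<in>P. y divides g' \<longrightarrow> y = \<one>) \<and> intertwines g' P Q"
proof -
  note Pc = parabolic_subset[OF P] and Qc = parabolic_subset[OF Q]
  have bP: "b \<in> P" and cQ: "c \<in> Q" using b c by (auto simp: full_def)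
  have bc: "b \<in> carrier M" and cc: "c \<in> carrier M" using bP cQ Pc Qc by auto
  define p where "p = head M P g"
  have p: "p \<in> P" "p \<in> carrier M" "p divides g" "\<And>y. y \<in> P \<Longrightarrow> y divides g \<Longrightarrow> y divides p"
    using headD[OF P g] by (auto simp: p_def)
  obtain g' where g': "g' \<in> carrier M" "g = p \<otimes> g'" using p by (auto simp: factor_def)
  have "p divides b \<otimes> g" unfolding bg using p g cc divides_prod_r by blast
  then have "p divides b \<otimes> p" using head_mult[OF P bP g p(1)] by (simp add: p_def)
  then obtain b' where b': "b' \<in> carrier M" "b \<otimes> p = p \<otimes> b'" by (auto simp: factor_def)
  have b'P: "b' \<in> P"
    using parabolic_of_mult(2)[OF P _ p(2) b'(1)] parabolic_mult[OF P bP p(1)] b'(2) by simp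
  have full': "full P b'"
    unfolding full_def
  proof (intro conjI ballI)
    fix x assume x: "x \<in> P"
    have xc: "x \<in> carrier M" using x Pc by blast
    obtain j :: nat where j: "p \<otimes> x divides b [^] j"
      using b parabolic_mult[OF P p(1) x] by (auto simp: full_def)
    then have "p \<otimes> x divides b [^] j \<otimes> p" using p xc bc divides_prod_r by blast
    then have "p \<otimes> x divides p \<otimes> b' [^] j" using conj_pow[OF bc b'(1) p(2) b'(2)] by simp
    then show "\<exists>j::nat. x divides b' [^] j" using p xc b'(1) by (auto simp: divides_mult_l)
  qed (rule b'P)
  have "p \<otimes> (b' \<otimes> g') = (b \<otimes> p) \<otimes> g'" using b' g'(1) p(2) m_assoc by simp
  also have "\<dots> = p \<otimes> (g' \<otimes> c)" using bg g' bc cc p(2) m_assoc by simp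
  finally have bg': "b' \<otimes> g' = g' \<otimes> c" using l_cancel p(2) g'(1) b'(1) cc by (meson m_closed)
  have red: "y = \<one>" if y: "y \<in> P" "y divides g'" for y
  proof -
    have yc: "y \<in> carrier M" using y Pc by blast
    have "p \<otimes> y divides g" using y yc g' p(2) by (simp add: divides_mult_l)
    then have "p \<otimes> y divides p" using p(4) parabolic_mult[OF P p(1) y(1)] by blast
    then have "p \<otimes> y = p"
      using p(2) yc by (intro divides_antisym) (auto simp: factor_def)
    then show "y = \<one>" using eq_mult_right_imp_one p(2) yc by blast
  qed
  have "intertwines g' P Q"
    using full_conj_intertwines[OF Q c g'(1) P full' bg'] red by blast
  then show ?thesis using red by blast
qed

text \<open>Conjugation matches the atoms of \<open>P\<close> with those of \<open>Q\<close>, hence the two lcms of atoms.\<close>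

lemma intertwines_delta:
  assumes P: "standard_parabolic M P" and Q: "standard_parabolic M Q" and i: "intertwines g P Q"
  shows "\<delta> P \<otimes> g = g \<otimes> \<delta> Q"
proof -
  note g = intertwinesD[OF i]
  note Pc = parabolic_subset[OF P] and Qc = parabolic_subset[OF Q]
  note dP = delta_closed[OF P] and dQ = delta_closed[OF Q]
  have eqP: "a = b" if "a \<in> P" "b \<in> P" "c \<in> Q" "a \<otimes> g = g \<otimes> c" "b \<otimes> g = g \<otimes> c" for a b c
    using that r_cancel[of a g b] g(1) Pc by simp
  have eqQ: "c = d" if "a \<in> P" "c \<in> Q" "d \<in> Q" "a \<otimes> g = g \<otimes> c" "a \<otimes> g = g \<otimes> d" for a c d
    using that l_cancel[of g c d] g(1) Qc by simp
  have unit: "a = \<one> \<longleftrightarrow> c = \<one>" if "a \<in> P" "c \<in> Q" "a \<otimes> g = g \<otimes> c" for a c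
    using that g(1) eq_mult_left_imp_one[of g a] eq_mult_right_imp_one[of g c] Pc Qc by auto
  have mult: "(a \<otimes> b) \<otimes> g = g \<otimes> (c \<otimes> d)"
    if "a \<in> P" "b \<in> P" "c \<in> Q" "d \<in> Q" "a \<otimes> g = g \<otimes> c" "b \<otimes> g = g \<otimes> d" for a b c d
    using conj_mult that Pc Qc g(1) by blast
  have atomQ: "c \<in> atoms M" if a: "a \<in> atoms M" "a \<in> P" and c: "c \<in> Q" "a \<otimes> g = g \<otimes> c" for a c
    unfolding atom_iff
  proof (intro conjI ballI impI)
    fix u v assume uv: "u \<in> carrier M" "v \<in> carrier M" "c = u \<otimes> v"
    then have Q: "u \<in> Q" "v \<in> Q" using parabolic_of_mult[OF Q, of u v] c by auto
    then obtain x y where xy: "x \<in> P" "y \<in> P" "x \<otimes> g = g \<otimes> u" "y \<otimes> g = g \<otimes> v"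
      using g(3) by meson
    then have "(x \<otimes> y) \<otimes> g = g \<otimes> c" using mult Q uv by blast
    then have "a = x \<otimes> y" using eqP[of a "x \<otimes> y" c] parabolic_mult[OF P] xy a c by blast
    then have "x = \<one> \<or> y = \<one>" using a xy Pc by (auto simp: atom_iff)
    then show "u = \<one> \<or> v = \<one>" using unit Q xy by blast
  qed (use unit[OF a(2) c] a c Qc in \<open>auto simp: atom_iff\<close>)
  have atomP: "a \<in> atoms M" if a: "a \<in> P" and c: "c \<in> atoms M" "c \<in> Q" "a \<otimes> g = g \<otimes> c" for a c
    unfolding atom_iff
  proof (intro conjI ballI impI)
    fix x y assume xy: "x \<in> carrier M" "y \<in> carrier M" "a = x \<otimes> y"
    then have P: "x \<in> P" "y \<in> P" using parabolic_of_mult[OF P, of x y] a by auto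
    then obtain u v where uv: "u \<in> Q" "v \<in> Q" "x \<otimes> g = g \<otimes> u" "y \<otimes> g = g \<otimes> v"
      using g(2) by meson
    then have "a \<otimes> g = g \<otimes> (u \<otimes> v)" using mult P xy by blast
    then have "c = u \<otimes> v" using eqQ[of a c "u \<otimes> v"] parabolic_mult[OF Q] uv a c by blast
    then have "u = \<one> \<or> v = \<one>" using c uv Qc by (auto simp: atom_iff)
    then show "x = \<one> \<or> y = \<one>" using unit P uv by blast
  qed (use unit[OF a c(2,3)] a c Pc in \<open>auto simp: atom_iff\<close>)
  have lP: "is_right_lcm_of_set M (\<delta> P) (atoms M \<inter> P)" and lQ: "is_right_lcm_of_set M (\<delta> Q) (atoms M \<inter> Q)"
    using delta_lcm P Q by auto
  obtain x where x: "x \<in> Q" "\<delta> P \<otimes> g = g \<otimes> x" using g(2)[OF dP(1)] by blast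
  obtain d where d: "d \<in> P" "d \<otimes> g = g \<otimes> \<delta> Q" using g(3)[OF dQ(1)] by blast
  have "\<delta> Q divides x"
  proof -
    have "t divides x" if t: "t \<in> atoms M" "t \<in> Q" for t
    proof -
      obtain s where s: "s \<in> P" "s \<otimes> g = g \<otimes> t" using g(3)[OF t(2)] by blast
      then have "s divides \<delta> P" using atomP[OF s(1) t s(2)] lP by (auto simp: is_right_lcm_of_set_def)
      then obtain y where y: "y \<in> carrier M" "\<delta> P = s \<otimes> y" by (auto simp: factor_def)
      then have "y \<in> P" using parabolic_of_mult(2)[OF P, of s y] dP s Pc by auto
      then obtain z where z: "z \<in> Q" "y \<otimes> g = g \<otimes> z" using g(2) by blast
      have "\<delta> P \<otimes> g = g \<otimes> (t \<otimes> z)" using mult[OF s(1) \<open>y \<in> P\<close> t(2) z(1) s(2) z(2)] y(2) by simp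
      then have "x = t \<otimes> z" using eqQ[OF dP(1) x(1) _ x(2)] parabolic_mult[OF Q t(2) z(1)] by blast
      then show ?thesis using z Qc by (auto simp: factor_def)
    qed
    then show ?thesis using lQ x Qc by (auto simp: is_right_lcm_of_set_def)
  qed
  then obtain y' where y': "y' \<in> carrier M" "x = \<delta> Q \<otimes> y'" by (auto simp: factor_def)
  then have y'Q: "y' \<in> Q" using parabolic_of_mult(2)[OF Q, of "\<delta> Q" y'] x dQ by auto
  then obtain y where y: "y \<in> P" "y \<otimes> g = g \<otimes> y'" using g(3) by blast
  have "(d \<otimes> y) \<otimes> g = g \<otimes> x" using mult[OF d(1) y(1) dQ(1) y'Q d(2) y(2)] y'(2) by simp
  then have dy: "\<delta> P = d \<otimes> y"
    using eqP[OF dP(1) _ x(1) x(2)] parabolic_mult[OF P d(1) y(1)] by blast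
  have "\<delta> P divides d"
  proof -
    have "s divides d" if s: "s \<in> atoms M" "s \<in> P" for s
    proof -
      obtain t where t: "t \<in> Q" "s \<otimes> g = g \<otimes> t" using g(2)[OF s(2)] by blast
      then have "t divides \<delta> Q" using atomQ[OF s t] lQ by (auto simp: is_right_lcm_of_set_def)
      then obtain z where z: "z \<in> carrier M" "\<delta> Q = t \<otimes> z" by (auto simp: factor_def)
      then have "z \<in> Q" using parabolic_of_mult(2)[OF Q, of t z] dQ t Qc by auto
      then obtain w where w: "w \<in> P" "w \<otimes> g = g \<otimes> z" using g(3) by blast
      have "(s \<otimes> w) \<otimes> g = g \<otimes> \<delta> Q" using mult[OF s(2) w(1) t(1) \<open>z \<in> Q\<close> t(2) w(2)] z(2) by simp
      then have "d = s \<otimes> w" using eqP[OF d(1) _ dQ(1) d(2)] parabolic_mult[OF P s(2) w(1)] by blast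
      then show ?thesis using w Pc by (auto simp: factor_def)
    qed
    then show ?thesis using lP d Pc by (auto simp: is_right_lcm_of_set_def)
  qed
  moreover have "d divides \<delta> P" using dy y Pc by (auto simp: factor_def)
  ultimately have "\<delta> P = d" using divides_antisym dP d Pc by blast
  then show ?thesis using d by simp
qed

end

section \<open>Passing to the group of fractions\<close>

locale garside_fractions =
  fixes M :: "('a, 'm) monoid_scheme" and \<Delta> :: 'a and G :: "('a, 'g) monoid_scheme" (structure)
  assumes garside: "lcm_garside_monoid M \<Delta>" and fractions: "group_of_fractions M G"
    and Delta_central: "\<exists>n::nat. n > 0 \<and>
      (\<forall>x\<in>carrier M. \<Delta> [^]\<^bsub>M\<^esub> n \<otimes>\<^bsub>M\<^esub> x = x \<otimes>\<^bsub>M\<^esub> \<Delta> [^]\<^bsub>M\<^esub> n)"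

sublocale garside_fractions \<subseteq> Mon: lcm_garside_monoid M \<Delta>
  by (rule garside)

sublocale garside_fractions \<subseteq> group G
  using fractions by (simp add: group_of_fractions_def)

context garside_fractions
begin

lemma in_G: "a \<in> carrier M \<Longrightarrow> a \<in> carrier G"
  using group_of_fractions.carrier_subset[OF fractions] by blast

lemma one_M: "\<one>\<^bsub>M\<^esub> = \<one>"
  by (rule group_of_fractions.one_eq[OF fractions])

lemma mult_M: "a \<in> carrier M \<Longrightarrow> b \<in> carrier M \<Longrightarrow> a \<otimes>\<^bsub>M\<^esub> b = a \<otimes> b"
  by (rule group_of_fractions.mult_eq[OF fractions])

lemma pow_M: "a \<in> carrier M \<Longrightarrow> a [^]\<^bsub>M\<^esub> (n::nat) = a [^] n"
proof (induction n)
  case (Suc n)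
  have "a [^]\<^bsub>M\<^esub> Suc n = a [^]\<^bsub>M\<^esub> n \<otimes> a" using Suc.prems mult_M by simp
  then show ?case using Suc by simp
qed (simp add: one_M)

lemma mult_M_assoc:
  assumes "a \<in> carrier M" "b \<in> carrier M" "c \<in> carrier M"
  shows "a \<otimes>\<^bsub>M\<^esub> (b \<otimes>\<^bsub>M\<^esub> c) = a \<otimes> (b \<otimes> c)" "(a \<otimes>\<^bsub>M\<^esub> b) \<otimes>\<^bsub>M\<^esub> c = (a \<otimes> b) \<otimes> c"
  using assms by (metis mult_M Mon.m_closed)+

lemma mult_inv_cancel:
  assumes "x \<in> carrier G" "y \<in> carrier G"
  shows "x \<otimes> (inv x \<otimes> y) = y" "inv x \<otimes> (x \<otimes> y) = y"
  using assms by (simp_all add: m_assoc[symmetric])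

lemma parabolic_in_G:
  assumes "standard_parabolic M P" "x \<in> P"
  shows "x \<in> carrier G"
  using assms Mon.parabolic_subset in_G by blast

lemma parabolic_mult_G:
  assumes "standard_parabolic M P" "x \<in> P" "y \<in> P"
  shows "x \<otimes> y \<in> P"
  using assms Mon.parabolic_mult mult_M Mon.parabolic_subset by metis

lemma conj_closed:
  assumes "b \<in> carrier G" "g \<in> carrier G"
  shows "conj_elt G b g \<in> carrier G"
  using assms by (simp add: conj_elt_def)

lemma conj_eq_iff:
  assumes "b \<in> carrier G" "c \<in> carrier G" "g \<in> carrier G"
  shows "conj_elt G b g = c \<longleftrightarrow> b \<otimes> g = g \<otimes> c"
  using assms by (auto simp: conj_elt_def m_assoc mult_inv_cancel)

lemma conj_hom:
  assumes "g \<in> carrier G"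
  shows "(\<lambda>b. conj_elt G b g) \<in> hom G G"
proof (rule homI)
  fix x y assume "x \<in> carrier G" "y \<in> carrier G"
  then have "x \<otimes> y \<otimes> g = g \<otimes> (conj_elt G x g \<otimes> conj_elt G y g)"
    using assms conj_closed conj_eq_iff by (metis m_assoc m_closed)
  then show "conj_elt G (x \<otimes> y) g = conj_elt G x g \<otimes> conj_elt G y g"
    using \<open>x \<in> carrier G\<close> \<open>y \<in> carrier G\<close> assms conj_closed conj_eq_iff by simp
qed (use assms conj_closed in auto)

lemma conj_group_hom:
  assumes "g \<in> carrier G"
  shows "group_hom G G (\<lambda>b. conj_elt G b g)"
  using conj_hom[OF assms] by unfold_locales

lemma conj_conj:
  assumes "b \<in> carrier G" "g \<in> carrier G" "h \<in> carrier G"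
  shows "conj_elt G (conj_elt G b g) h = conj_elt G b (g \<otimes> h)"
  using assms by (simp add: conj_elt_def inv_mult_group m_assoc)

lemma conj_set_generate:
  assumes "P \<subseteq> carrier G" "g \<in> carrier G"
  shows "conj_set G (generate G P) g = generate G (conj_set G P g)"
  using group_hom.generate_img[OF conj_group_hom[OF assms(2)] assms(1)]
  by (simp add: conj_set_def image_def Setcompr_eq_image)

lemma intertwines_iff_conj_set:
  assumes "g \<in> carrier M" "P \<subseteq> carrier M" "Q \<subseteq> carrier M"
  shows "Mon.intertwines g P Q \<longleftrightarrow> conj_set G P g = Q"
proof -
  have e: "a \<otimes>\<^bsub>M\<^esub> g = g \<otimes>\<^bsub>M\<^esub> b \<longleftrightarrow> conj_elt G a g = b" if "a \<in> P" "b \<in> Q" for a b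
    using that assms conj_eq_iff[of a b g] in_G mult_M by (metis subsetD)
  have "Mon.intertwines g P Q \<longleftrightarrow>
      (\<forall>a\<in>P. \<exists>b\<in>Q. conj_elt G a g = b) \<and> (\<forall>b\<in>Q. \<exists>a\<in>P. conj_elt G a g = b)"
    unfolding Mon.intertwines_def using assms(1) e by (simp cong: ball_cong bex_cong)
  also have "\<dots> \<longleftrightarrow> conj_set G P g = Q"
    unfolding conj_set_def by (auto; blast)
  finally show ?thesis .
qed

lemma Delta_M: "head M (carrier M) \<Delta> = \<Delta>"
  using Mon.Delta_closed
  by (intro Mon.head_equality Mon.carrier_parabolic) (auto simp: is_head_def)

text \<open>The denominator of \<open>g\<close> divides a power of \<open>\<Delta>\<close> that is central, and this power serves as \<open>z\<close>.
  Conjugation by \<open>g\<close> is thereby conjugation by an element of \<open>M\<close>.\<close>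

lemma central_denominator:
  assumes g: "g \<in> carrier G"
  shows "\<exists>z\<in>carrier G. z \<otimes> g \<in> carrier M \<and> (\<forall>x\<in>carrier G. z \<otimes> x = x \<otimes> z)"
proof -
  obtain a b where ab: "a \<in> carrier M" "b \<in> carrier M" "g = inv a \<otimes> b"
    using group_of_fractions.fraction[OF fractions g] by blast
  obtain n :: nat where n: "n > 0"
    "\<And>x. x \<in> carrier M \<Longrightarrow> \<Delta> [^]\<^bsub>M\<^esub> n \<otimes>\<^bsub>M\<^esub> x = x \<otimes>\<^bsub>M\<^esub> \<Delta> [^]\<^bsub>M\<^esub> n"
    using Delta_central by blast
  have "Mon.full (carrier M) (\<Delta> [^]\<^bsub>M\<^esub> n)"
    using Mon.delta_pow_full[OF Mon.carrier_parabolic n(1)] Delta_M by simp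
  then obtain j :: nat where "a divides\<^bsub>M\<^esub> (\<Delta> [^]\<^bsub>M\<^esub> n) [^]\<^bsub>M\<^esub> j"
    using ab by (auto simp: Mon.full_def)
  then obtain c where c: "c \<in> carrier M" "(\<Delta> [^]\<^bsub>M\<^esub> n) [^]\<^bsub>M\<^esub> j = a \<otimes>\<^bsub>M\<^esub> c"
    by (auto simp: factor_def)
  define z where "z = (\<Delta> [^]\<^bsub>M\<^esub> n) [^]\<^bsub>M\<^esub> j"
  have zM: "z \<in> carrier M" using Mon.Delta_closed by (simp add: z_def)
  have zG: "z \<in> carrier G" using in_G zM by blast
  have zc: "z \<otimes> x = x \<otimes> z" if x: "x \<in> carrier M" for x
  proof -
    have "x \<otimes>\<^bsub>M\<^esub> z = z \<otimes>\<^bsub>M\<^esub> x"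
      unfolding z_def
      using n(2)[OF x] x Mon.Delta_closed
      by (metis Mon.nat_pow_closed Mon.nat_pow_comm Mon.pow_mult_distrib Mon.conj_pow)
    then show ?thesis using mult_M x zM by simp
  qed
  have zG': "z \<otimes> x = x \<otimes> z" if x: "x \<in> carrier G" for x
  proof -
    obtain u v where uv: "u \<in> carrier M" "v \<in> carrier M" "x = inv u \<otimes> v"
      using group_of_fractions.fraction[OF fractions x] by blast
    have u: "u \<in> carrier G" and v: "v \<in> carrier G" using uv in_G by auto
    have "u \<otimes> (z \<otimes> inv u \<otimes> v) = (u \<otimes> z) \<otimes> inv u \<otimes> v"
      using u v zG by (simp add: m_assoc)
    also have "\<dots> = z \<otimes> v"
      unfolding zc[OF uv(1), symmetric] using u v zG by (simp add: m_assoc)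
    also have "\<dots> = u \<otimes> (inv u \<otimes> v \<otimes> z)"
      using u v zG zc[OF uv(2)] by (simp add: m_assoc[symmetric])
    finally have "z \<otimes> inv u \<otimes> v = inv u \<otimes> v \<otimes> z"
      using u v zG by (metis inv_closed l_cancel m_closed)
    then show ?thesis using uv(3) u v zG by (simp add: m_assoc)
  qed
  have G: "a \<in> carrier G" "b \<in> carrier G" "c \<in> carrier G" using ab c in_G by auto
  have "z = a \<otimes> c" using c ab mult_M by (simp add: z_def)
  then have "inv a \<otimes> z = c" using G by (simp add: m_assoc[symmetric])
  then have "z \<otimes> g = c \<otimes> b"
    using ab(3) G zG zG'[of "inv a"] by (simp add: m_assoc[symmetric])
  then have "z \<otimes> g \<in> carrier M" using c ab mult_M Mon.m_closed by metis
  then show ?thesis using zG zG' by blast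
qed

lemma conj_central:
  assumes "z \<in> carrier G" "\<forall>x\<in>carrier G. z \<otimes> x = x \<otimes> z" "g \<in> carrier G" "b \<in> carrier G"
  shows "conj_elt G b (z \<otimes> g) = conj_elt G b g"
proof -
  have "conj_elt G b z = b" using conj_eq_iff[of b b z] assms by simp
  then show ?thesis using conj_conj[of b z g] assms by simp
qed

text \<open>Fractions compose because the lcm of \<open>v\<close> and \<open>u'\<close>, which rewrites \<open>v\<inverse> u'\<close> as \<open>y y'\<inverse>\<close>, stays
  in \<open>P\<close>.\<close>

lemma generate_fraction:
  assumes P: "standard_parabolic M P" and "x \<in> generate G P"
  shows "\<exists>u\<in>P. \<exists>v\<in>P. x = u \<otimes> inv v"
  using assms(2)
proof induction
  case one
  then show ?case using Mon.parabolic_one[OF P] one_M by (metis inv_one one_closed r_one)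
next
  case (incl h)
  then show ?case
    using Mon.parabolic_one[OF P] one_M parabolic_in_G[OF P] by (metis inv_one r_one)
next
  case (inv h)
  then show ?case
    using Mon.parabolic_one[OF P] one_M parabolic_in_G[OF P] by (metis inv_closed l_one)
next
  case (eng h1 h2)
  then obtain u v u' v' where uv: "u \<in> P" "v \<in> P" "h1 = u \<otimes> inv v" "u' \<in> P" "v' \<in> P" "h2 = u' \<otimes> inv v'"
    by blast
  note Pc = Mon.parabolic_subset[OF P] and PG = parabolic_in_G[OF P]
  obtain m where m: "m \<in> carrier M" "m lcmof\<^bsub>M\<^esub> v u'"
    using Mon.right_lcm_exists Pc uv by meson
  then have mP: "m \<in> P" using Mon.parabolic_right_lcm[OF P uv(2,4)] by blast
  obtain y y' where y: "y \<in> carrier M" "m = v \<otimes>\<^bsub>M\<^esub> y" "y' \<in> carrier M" "m = u' \<otimes>\<^bsub>M\<^esub> y'"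
    using m by (auto simp: islcm_def factor_def)
  have yP: "y \<in> P" "y' \<in> P"
    using Mon.parabolic_of_mult(2)[OF P, of v y] Mon.parabolic_of_mult(2)[OF P, of u' y'] y mP Pc uv by auto
  have G: "u \<in> carrier G" "v \<in> carrier G" "u' \<in> carrier G" "v' \<in> carrier G" "y \<in> carrier G" "y' \<in> carrier G"
    using uv yP PG by auto
  have "v \<otimes> y = u' \<otimes> y'" using y mult_M Pc uv by metis
  then have "inv v \<otimes> u' = y \<otimes> inv y'"
    using G by (metis inv_solve_left inv_solve_right inv_closed m_assoc m_closed)
  then have "h1 \<otimes> h2 = u \<otimes> (y \<otimes> inv y') \<otimes> inv v'"
    unfolding uv using G by (metis inv_closed m_assoc m_closed)
  also have "\<dots> = (u \<otimes> y) \<otimes> inv (v' \<otimes> y')"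
    using G by (simp add: inv_mult_group m_assoc)
  finally show ?case using parabolic_mult_G[OF P] uv yP by blast
qed

lemma generate_subgroup:
  assumes "standard_parabolic M P"
  shows "subgroup (generate G P) G"
  using parabolic_in_G[OF assms] by (intro generate_is_subgroup) blast

text \<open>If \<open>w\<^sup>g = u v\<inverse>\<close> with \<open>u, v \<in> Q\<close>, then \<open>v\<close> is a right divisor of \<open>g u\<close>. Since \<open>g\<close> has no
  right divisor in \<open>Q\<close> other than \<open>\<one>\<close>, it follows that \<open>v\<close> is a right divisor of \<open>u\<close>, so that
  \<open>u v\<inverse>\<close> has no denominator after all.\<close>

lemma conj_in_parabolic:
  assumes Q: "standard_parabolic M Q" and g: "g \<in> carrier M" and w: "w \<in> carrier M"
    and red: "\<And>y. y \<in> Q \<Longrightarrow> right_divides M y g \<Longrightarrow> y = \<one>\<^bsub>M\<^esub>"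
    and wg: "conj_elt G w g \<in> generate G Q"
  shows "conj_elt G w g \<in> Q"
proof -
  note Qc = Mon.parabolic_subset[OF Q] and QG = parabolic_in_G[OF Q]
  obtain u v where uv: "u \<in> Q" "v \<in> Q" "conj_elt G w g = u \<otimes> inv v"
    using generate_fraction[OF Q wg] by blast
  have G: "u \<in> carrier G" "v \<in> carrier G" "w \<in> carrier G" "g \<in> carrier G"
    using uv QG g w in_G by auto
  have "w \<otimes> g = g \<otimes> (u \<otimes> inv v)" using conj_eq_iff G uv(3) by simp
  then have "w \<otimes> g \<otimes> v = g \<otimes> u" using G by (simp add: m_assoc)
  then have e: "(w \<otimes>\<^bsub>M\<^esub> g) \<otimes>\<^bsub>M\<^esub> v = g \<otimes>\<^bsub>M\<^esub> u"
    using g w uv Qc mult_M mult_M_assoc(2) by simp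
  have "right_divides M v (g \<otimes>\<^bsub>M\<^esub> u)"
    unfolding right_divides_def using e g w by (metis Mon.m_closed)
  then have "right_divides M v u"
    using Mon.right_divides_cancel_reduced[OF Q uv(1,2) g] red by blast
  then obtain x where x: "x \<in> carrier M" "u = x \<otimes>\<^bsub>M\<^esub> v" by (auto simp: right_divides_def)
  then have "x \<in> Q" using Mon.parabolic_of_mult(1)[OF Q, of x v] uv Qc by auto
  moreover have "u \<otimes> inv v = x"
    using x uv Qc mult_M[of x v] G in_G[of x] by (simp add: m_assoc)
  ultimately show ?thesis using uv(3) by simp
qed

text \<open>There are only finitely many cosets, so the powers of \<open>x\<close> with some two different exponents lie in the same one.\<close>

lemma pow_in_finite_index:
  assumes K: "subgroup K G" and H: "subgroup H G"
    and fin: "finite_index G (K \<inter> H) K" and x: "x \<in> K"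
  shows "\<exists>m::nat. m > 0 \<and> x [^] m \<in> H"
proof -
  let ?f = "\<lambda>n::nat. (K \<inter> H) #> (x [^] n)"
  have xG: "x \<in> carrier G" using K x by (rule subgroup.mem_carrier)
  have xK: "x [^] n \<in> K" for n :: nat
    by (induction n) (use K x in \<open>auto simp: subgroup.one_closed subgroup.m_closed\<close>)
  have "range ?f \<subseteq> rcosets\<^bsub>G\<lparr>carrier := K\<rparr>\<^esub> (K \<inter> H)"
    using xK by (auto simp: RCOSETS_def r_coset_def)
  then have "finite (range ?f)"
    using fin finite_subset by (auto simp: finite_index_def)
  then have "\<not> inj ?f" using finite_imageD infinite_UNIV_nat by blast
  then obtain i j :: nat where ij: "i < j" "?f i = ?f j"
    unfolding inj_def by (metis linorder_neqE_nat)
  have "x [^] j \<in> ?f j"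
    using K H xG by (auto simp: r_coset_def subgroup.one_closed intro!: bexI[of _ \<one>])
  then obtain h where h: "h \<in> K \<inter> H" "x [^] j = h \<otimes> x [^] i"
    using ij by (auto simp: r_coset_def)
  have "x [^] (j - i) \<otimes> x [^] i = x [^] j" using ij xG by (simp add: nat_pow_mult)
  then have "x [^] (j - i) = h"
    using h H xG subgroup.mem_carrier[OF H] by (metis IntD2 nat_pow_closed r_cancel)
  then show ?thesis using h ij by (intro exI[of _ "j - i"]) auto
qed

text \<open>Once the right \<open>Q\<close>-head of \<open>g\<close> has been removed, the conjugate \<open>q\<close> of \<open>\<delta> P\<^sup>k\<close> lies in \<open>Q\<close>. It is
  full: for \<open>y \<in> Q\<close> some power \<open>y\<^sup>m\<close> with \<open>m > 0\<close> is the conjugate of an element \<open>x\<close> of the group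
  generated by \<open>P\<close>, and multiplying \<open>x\<inverse>\<close> by a large power of \<open>\<delta> P\<^sup>k\<close> puts it in \<open>P\<close>, so that \<open>y\<^sup>m\<close>
  divides a power of \<open>q\<close>.\<close>

lemma commensurable_imp_intertwines:
  assumes P: "standard_parabolic M P" and Q: "standard_parabolic M Q" and g: "g \<in> carrier M"
    and k: "k > 0" "conj_elt G (Mon.parabolic_Delta P [^] (k::nat)) g \<in> generate G Q"
    and Qpow: "\<And>y. y \<in> generate G Q \<Longrightarrow> \<exists>m::nat. m > 0 \<and> (\<exists>x\<in>generate G P. conj_elt G x g = y [^] m)"
  shows "\<exists>g'. (\<forall>y\<in>P. y divides\<^bsub>M\<^esub> g' \<longrightarrow> y = \<one>\<^bsub>M\<^esub>) \<and> Mon.intertwines g' P Q"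
proof -
  note Pc = Mon.parabolic_subset[OF P] and Qc = Mon.parabolic_subset[OF Q]
  note PG = parabolic_in_G[OF P] and QG = parabolic_in_G[OF Q]
  note sQ = generate_subgroup[OF Q]
  note sP = generate_subgroup[OF P]
  define b where "b = Mon.parabolic_Delta P [^]\<^bsub>M\<^esub> k"
  have bfull: "Mon.full P b" unfolding b_def by (rule Mon.delta_pow_full[OF P k(1)])
  then have bP: "b \<in> P" by (simp add: Mon.full_def)
  have bg: "conj_elt G b g \<in> generate G Q"
    using k(2) pow_M Mon.delta_closed(2)[OF P] by (simp add: b_def)
  obtain h where h: "is_right_head M Q g h"
    using Q g by (auto simp: standard_parabolic_def)
  then have hQ: "h \<in> Q" by (simp add: is_right_head_def)
  obtain g' where g': "g' \<in> carrier M" "g = g' \<otimes>\<^bsub>M\<^esub> h"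
    using h by (auto simp: is_right_head_def right_divides_def)
  have red: "y = \<one>\<^bsub>M\<^esub>" if y: "y \<in> Q" "right_divides M y g'" for y
  proof -
    obtain c where c: "c \<in> carrier M" "g' = c \<otimes>\<^bsub>M\<^esub> y" using y by (auto simp: right_divides_def)
    then have "g = c \<otimes>\<^bsub>M\<^esub> (y \<otimes>\<^bsub>M\<^esub> h)" using g' Qc y hQ Mon.m_assoc by simp
    then have "right_divides M (y \<otimes>\<^bsub>M\<^esub> h) g" using c by (auto simp: right_divides_def)
    then have "right_divides M (y \<otimes>\<^bsub>M\<^esub> h) h"
      using h Mon.parabolic_mult[OF Q y(1) hQ] by (auto simp: is_right_head_def)
    then have "is_factor M (y \<otimes>\<^bsub>M\<^esub> h) h"
      using Mon.right_divides_imp_factor Qc y(1) hQ Mon.m_closed by blast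
    moreover have "is_factor M h (y \<otimes>\<^bsub>M\<^esub> h)"
      using Mon.right_divides_imp_factor[of h "y \<otimes>\<^bsub>M\<^esub> h"] Qc y(1) hQ
      by (auto simp: right_divides_def)
    ultimately have "y \<otimes>\<^bsub>M\<^esub> h = h" by (rule Mon.factor_antisym)
    then show ?thesis using Mon.eq_mult_left_imp_one Qc hQ y(1) by blast
  qed
  have G: "h \<in> carrier G" "g' \<in> carrier G" "b \<in> carrier G" "g \<in> carrier G"
    using hQ QG g' g bP PG in_G by auto
  have gG: "g = g' \<otimes> h" using g' mult_M hQ Qc by simp
  have hgen: "h \<in> generate G Q" "inv h \<in> generate G Q"
    using hQ generate.incl generate.inv by metis+
  have undo: "conj_elt G x g' = h \<otimes> conj_elt G x g \<otimes> inv h" if "x \<in> carrier G" for x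
    unfolding gG using that G by (simp add: conj_elt_def inv_mult_group m_assoc mult_inv_cancel)
  define q where "q = conj_elt G b g'"
  have qgen: "q \<in> generate G Q"
    unfolding q_def undo[OF G(3)] using bg hgen sQ by (auto intro!: subgroup.m_closed)
  have qQ: "q \<in> Q"
    unfolding q_def
    using conj_in_parabolic[OF Q g'(1) _ red] qgen bP Pc by (simp add: q_def)
  have qG: "q \<in> carrier G" using qQ QG by blast
  interpret cj: group_hom G G "\<lambda>x. conj_elt G x g'" by (rule conj_group_hom[OF G(2)])
  have qfull: "Mon.full Q q"
    unfolding Mon.full_def
  proof (intro conjI ballI)
    fix y assume y: "y \<in> Q"
    have yG: "y \<in> carrier G" using y QG by blast
    have "conj_elt G y h \<in> generate G Q"
      unfolding conj_elt_def using y hgen sQ generate.incl by (metis subgroup.m_closed)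
    then obtain m :: nat and x where m: "m > 0" and x: "x \<in> generate G P"
      and xg: "conj_elt G x g = conj_elt G y h [^] m"
      using Qpow by blast
    have xG: "x \<in> carrier G" using x sP subgroup.mem_carrier by metis
    interpret ch: group_hom G G "\<lambda>x. conj_elt G x h" by (rule conj_group_hom[OF G(1)])
    have "conj_elt G x g = conj_elt G (y [^] m) h" unfolding xg using yG by (simp add: ch.hom_nat_pow)
    then have xg': "conj_elt G x g' = y [^] m"
      unfolding undo[OF xG] using yG G by (simp add: conj_elt_def m_assoc mult_inv_cancel)
    obtain u v where uv: "u \<in> P" "v \<in> P" "x = u \<otimes> inv v" using generate_fraction[OF P x] by blast
    obtain i :: nat where "u divides\<^bsub>M\<^esub> b [^]\<^bsub>M\<^esub> i" using bfull uv by (auto simp: Mon.full_def)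
    then obtain e where e: "e \<in> carrier M" "b [^]\<^bsub>M\<^esub> i = u \<otimes>\<^bsub>M\<^esub> e" by (auto simp: factor_def)
    have uvG: "u \<in> carrier G" "v \<in> carrier G" "e \<in> carrier G" using uv e PG in_G by auto
    have be: "b [^] i = u \<otimes> e" using e uv Pc bP pow_M mult_M by metis
    have "inv x \<otimes> b [^] i = v \<otimes> e"
      unfolding be uv(3) using uvG by (simp add: inv_mult_group m_assoc mult_inv_cancel)
    then have "conj_elt G (v \<otimes> e) g' = inv (y [^] m) \<otimes> q [^] i"
      using cj.hom_mult[of "inv x" "b [^] i"] xG G xg' by (simp add: cj.hom_nat_pow q_def)
    moreover have "inv (y [^] m) \<otimes> q [^] i \<in> generate G Q"
    proof -
      have "y [^] m \<in> generate G Q" "q [^] i \<in> generate G Q"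
        using Mon.parabolic_pow[OF Q] y qQ pow_M Qc generate.incl by metis+
      then show ?thesis using sQ by (simp add: subgroup.m_closed subgroup.m_inv_closed)
    qed
    moreover have "v \<otimes> e \<in> carrier M" using uv Pc e mult_M Mon.m_closed by metis
    ultimately have wQ: "inv (y [^] m) \<otimes> q [^] i \<in> Q"
      using conj_in_parabolic[OF Q g'(1) _ red] by metis
    let ?w = "inv (y [^] m) \<otimes> q [^] i"
    have "q [^] i = y [^] m \<otimes> ?w" using yG qG by (simp add: m_assoc[symmetric])
    also have "\<dots> = y \<otimes> (y [^] (m - 1) \<otimes> ?w)"
      using m yG qG nat_pow_Suc2[OF yG, of "m - 1"] by (simp add: m_assoc)
    finally have "q [^]\<^bsub>M\<^esub> i = y \<otimes>\<^bsub>M\<^esub> (y [^]\<^bsub>M\<^esub> (m - 1) \<otimes>\<^bsub>M\<^esub> ?w)"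
      using y qQ wQ Qc mult_M_assoc(1)[of y "y [^]\<^bsub>M\<^esub> (m - 1)" ?w] pow_M
      by (metis Mon.nat_pow_closed)
    then show "\<exists>j::nat. y divides\<^bsub>M\<^esub> q [^]\<^bsub>M\<^esub> j"
      using y wQ Qc unfolding factor_def by (metis Mon.m_closed Mon.nat_pow_closed)
  qed (rule qQ)
  have "b \<otimes> g' = g' \<otimes> q" using conj_eq_iff[OF G(3) qG G(2)] by (simp add: q_def)
  then have "b \<otimes>\<^bsub>M\<^esub> g' = g' \<otimes>\<^bsub>M\<^esub> q" using mult_M bP qQ Pc Qc g'(1) by simp
  then show ?thesis
    using Mon.full_conj_reduced_intertwines[OF P Q bfull qfull g'(1)] by blast
qed

lemma ribbonI:
  assumes P: "standard_parabolic M P" and Q: "standard_parabolic M Q"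
    and i: "Mon.intertwines g P Q" and red: "\<forall>y\<in>P. y divides\<^bsub>M\<^esub> g \<longrightarrow> y = \<one>\<^bsub>M\<^esub>"
  shows "ribbon M P g \<and> conj_set G P g = Q"
proof
  note gM = Mon.intertwinesD(1)[OF i]
  note hd = Mon.headD[OF P gM]
  have "p \<in> P \<Longrightarrow> g divides\<^bsub>M\<^esub> p \<otimes>\<^bsub>M\<^esub> g" for p
    using Mon.intertwinesD(2)[OF i] Mon.parabolic_subset[OF Q] unfolding factor_def by blast
  then show "ribbon M P g" using red hd(1,3) gM by (simp add: ribbon_def)
  show "conj_set G P g = Q"
    using intertwines_iff_conj_set[OF gM] i Mon.parabolic_subset P Q by blast
qed

lemma commensurable_imp_ribbon:
  assumes P: "standard_parabolic M P" and Q: "standard_parabolic M Q" and g: "g \<in> carrier G"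
    and fin: "finite_index G (conj_set G (generate G P) g \<inter> generate G Q) (conj_set G (generate G P) g)"
      "finite_index G (conj_set G (generate G P) g \<inter> generate G Q) (generate G Q)"
  shows "\<exists>g. ribbon M P g \<and> conj_set G P g = Q"
proof -
  let ?K = "conj_set G (generate G P) g"
  obtain z where z: "z \<in> carrier G" "z \<otimes> g \<in> carrier M" "\<forall>x\<in>carrier G. z \<otimes> x = x \<otimes> z"
    using central_denominator[OF g] by blast
  interpret cj: group_hom G G "\<lambda>x. conj_elt G x g" by (rule conj_group_hom[OF g])
  note sP = generate_subgroup[OF P] and sQ = generate_subgroup[OF Q]
  have Kim: "?K = (\<lambda>x. conj_elt G x g) ` generate G P" by (auto simp: conj_set_def)
  have sK: "subgroup ?K G" unfolding Kim by (rule cj.subgroup_img_is_subgroup[OF sP])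
  let ?d = "head M P \<Delta>"
  have dG: "?d \<in> carrier G" using Mon.delta_closed[OF P] in_G by blast
  have "?d \<in> generate G P" using Mon.delta_closed[OF P] generate.incl by metis
  then have "conj_elt G ?d g \<in> ?K" unfolding Kim by blast
  then obtain k :: nat where k: "k > 0" "conj_elt G ?d g [^] k \<in> generate G Q"
    using pow_in_finite_index[OF sK sQ fin(1)] by blast
  have k': "conj_elt G (?d [^] k) (z \<otimes> g) \<in> generate G Q"
    using k(2) dG conj_central[OF z(1,3) g, of "?d [^] k"] by (simp add: cj.hom_nat_pow)
  have "\<exists>m::nat. m > 0 \<and> (\<exists>x\<in>generate G P. conj_elt G x (z \<otimes> g) = y [^] m)"
    if y: "y \<in> generate G Q" for y
  proof -
    have "finite_index G (generate G Q \<inter> ?K) (generate G Q)" using fin(2) by (simp add: Int_commute)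
    then obtain m :: nat where m: "m > 0" "y [^] m \<in> ?K"
      using pow_in_finite_index[OF sQ sK _ y] by blast
    then obtain x where "x \<in> generate G P" "y [^] m = conj_elt G x g" unfolding Kim by blast
    then show ?thesis
      using m conj_central[OF z(1,3) g] subgroup.mem_carrier[OF sP] by metis
  qed
  then obtain g' where "\<forall>y\<in>P. y divides\<^bsub>M\<^esub> g' \<longrightarrow> y = \<one>\<^bsub>M\<^esub>" "Mon.intertwines g' P Q"
    using commensurable_imp_intertwines[OF P Q z(2) k(1) k'] by blast
  then show ?thesis using ribbonI[OF P Q] by blast
qed

lemma conj_delta_pow_imp_ribbon:
  assumes P: "standard_parabolic M P" and Q: "standard_parabolic M Q" and g: "g \<in> carrier G"
    and k: "k > 0" "conj_elt G (head M P \<Delta> [^]\<^bsub>M\<^esub> (k::nat)) g = head M Q \<Delta> [^]\<^bsub>M\<^esub> k"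
  shows "\<exists>g. ribbon M P g \<and> conj_set G P g = Q"
proof -
  obtain z where z: "z \<in> carrier G" "z \<otimes> g \<in> carrier M" "\<forall>x\<in>carrier G. z \<otimes> x = x \<otimes> z"
    using central_denominator[OF g] by blast
  let ?b = "head M P \<Delta> [^]\<^bsub>M\<^esub> k" and ?c = "head M Q \<Delta> [^]\<^bsub>M\<^esub> k"
  have M: "?b \<in> carrier M" "?c \<in> carrier M"
    using Mon.delta_closed P Q by auto
  have "conj_elt G ?b (z \<otimes> g) = ?c"
    using conj_central[OF z(1,3) g] k(2) in_G M by simp
  then have "?b \<otimes>\<^bsub>M\<^esub> (z \<otimes> g) = (z \<otimes> g) \<otimes>\<^bsub>M\<^esub> ?c"
    using conj_eq_iff M in_G z(2) mult_M by simp
  then obtain g' where "\<forall>y\<in>P. y divides\<^bsub>M\<^esub> g' \<longrightarrow> y = \<one>\<^bsub>M\<^esub>" "Mon.intertwines g' P Q"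
    using Mon.full_conj_reduced_intertwines[OF P Q Mon.delta_pow_full[OF P k(1)]
        Mon.delta_pow_full[OF Q k(1)] z(2)] by blast
  then show ?thesis using ribbonI[OF P Q] by blast
qed

lemma conj_set_imp_conj_delta:
  assumes P: "standard_parabolic M P" and Q: "standard_parabolic M Q"
    and g: "g \<in> carrier M" "conj_set G P g = Q"
  shows "conj_elt G (head M P \<Delta>) g = head M Q \<Delta>"
proof -
  have "Mon.intertwines g P Q"
    using intertwines_iff_conj_set[OF g(1)] g(2) Mon.parabolic_subset P Q by blast
  then have "head M P \<Delta> \<otimes>\<^bsub>M\<^esub> g = g \<otimes>\<^bsub>M\<^esub> head M Q \<Delta>"
    by (rule Mon.intertwines_delta[OF P Q])
  then show ?thesis
    using conj_eq_iff Mon.delta_closed(2) P Q g in_G mult_M by simp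
qed

lemma finite_index_self:
  assumes "subgroup H G"
  shows "finite_index G H H"
proof -
  have "subgroup H (G\<lparr>carrier := H\<rparr>)"
    using assms by (rule subgroup_incl) (use assms in auto)
  moreover have "H #> a = H" if "a \<in> H" for a
    using that assms coset_join2 subgroup.mem_carrier by metis
  then have "rcosets\<^bsub>G\<lparr>carrier := H\<rparr>\<^esub> H \<subseteq> {H}"
    by (auto simp: RCOSETS_def r_coset_def)
  ultimately show ?thesis
    using finite_subset by (auto simp: finite_index_def)
qed

end

theorem proposition26:
  fixes M :: "('a, 'm) monoid_scheme" and G :: "('a, 'g) monoid_scheme"
    and \<Delta> :: 'a and P Q :: "'a set"
  assumes "garside_monoid M \<Delta>"
    and "\<forall>S1 \<subseteq> atoms M. is_right_lcm_of_set M (head M (parabolic_closure M S1) \<Delta>) S1"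
    and "\<exists>n::nat. n > 0 \<and> (\<forall>x\<in>carrier M. \<Delta> [^]\<^bsub>M\<^esub> n \<otimes>\<^bsub>M\<^esub> x = x \<otimes>\<^bsub>M\<^esub> \<Delta> [^]\<^bsub>M\<^esub> n)"
    and "group_of_fractions M G"
    and "standard_parabolic M P" and "standard_parabolic M Q"
  shows "((\<exists>g\<in>carrier G.
             finite_index G (conj_set G (generate G P) g \<inter> generate G Q) (conj_set G (generate G P) g) \<and>
             finite_index G (conj_set G (generate G P) g \<inter> generate G Q) (generate G Q))
           \<longleftrightarrow> (\<exists>g\<in>carrier G. conj_set G (generate G P) g = generate G Q)) \<and>
         ((\<exists>g\<in>carrier G. conj_set G (generate G P) g = generate G Q)
           \<longleftrightarrow> (\<exists>k::nat. k > 0 \<and> (\<exists>g\<in>carrier G.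
                  conj_elt G (head M P \<Delta> [^]\<^bsub>M\<^esub> k) g = head M Q \<Delta> [^]\<^bsub>M\<^esub> k))) \<and>
         ((\<exists>k::nat. k > 0 \<and> (\<exists>g\<in>carrier G.
              conj_elt G (head M P \<Delta> [^]\<^bsub>M\<^esub> k) g = head M Q \<Delta> [^]\<^bsub>M\<^esub> k))
           \<longleftrightarrow> (\<exists>g. ribbon M P g \<and> conj_set G P g = Q))"
    (is "(?i \<longleftrightarrow> ?ii) \<and> (?ii \<longleftrightarrow> ?iii) \<and> (?iii \<longleftrightarrow> ?iv)")
proof -
  interpret garside_fractions M \<Delta> G
    using assms(1-4)
    by (simp add: garside_fractions_def lcm_garside_monoid_def lcm_garside_monoid_axioms_def)
  note P = assms(5) and Q = assms(6)
  have "?i \<Longrightarrow> ?iv"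
    using commensurable_imp_ribbon[OF P Q] by blast
  moreover have "?iii \<Longrightarrow> ?iv"
    using conj_delta_pow_imp_ribbon[OF P Q] by blast
  moreover have "?ii \<Longrightarrow> ?i"
    using finite_index_self[OF generate_subgroup[OF Q]] by (metis Int_absorb)
  moreover have "?iv \<Longrightarrow> ?ii \<and> ?iii"
  proof -
    assume ?iv
    then obtain g where g: "g \<in> carrier M" "conj_set G P g = Q" by (auto simp: ribbon_def)
    have "conj_set G (generate G P) g = generate G Q"
      using conj_set_generate[of P g] parabolic_in_G[OF P] in_G[OF g(1)] g(2) by blast
    moreover have "conj_elt G (head M P \<Delta> [^]\<^bsub>M\<^esub> (1::nat)) g = head M Q \<Delta> [^]\<^bsub>M\<^esub> (1::nat)"
      using conj_set_imp_conj_delta[OF P Q g] Mon.delta_closed(2) P Q by simp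
    ultimately show "?ii \<and> ?iii" using in_G[OF g(1)] zero_less_one by blast
  qed
  ultimately show ?thesis by blast
qed

end
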